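(* Let $\mathcal{A}$ be a finite set and let $d$ be in $\mathbb{N}$. For each $\alpha \in [0,1]$ and $\epsilon>0$, there exist $\rho>0$ and $n_0$ such that if $n \geq n_0$, then $$\mathbb{P}_{n,\alpha}\Bigl( \bigl| h(X_\omega) - \log^+(\alpha|\mathcal{A}|) \bigr| \geq \epsilon \Bigr) \leq \exp(-\rho n^d).$$
   Context: Here $d\ge 1$. Let $F_n = [1,n]^d \subset \mathbb{Z}^d$ (integer points). Let $\Omega_n$ be the power set of $\mathcal{A}^{F_n}$. For $n\ge 1$ and $\alpha\in[0,1]$, $\mathbb{P}_{n,\alpha}$ is the probability measure on $\Omega_n$ under which the random subset $\omega \subset \mathcal{A}^{F_n}$ includes each element of $\mathcal{A}^{F_n}$ independently with probability $\alpha$. For $\omega \subset \mathcal{A}^{F_n}$, $X_\omega$ is the $\mathbb{Z}^d$-shift of finite type $$X_\omega = \{x \in \mathcal{A}^{\mathbb{Z}^d} : \forall p \in \mathbb{Z}^d,\ x|_{F_n+p} \in \omega\},$$ where patterns are identified up to translation. The (topological) entropy of a $\mathbb{Z}^d$-shift of finite type $X$ is $$h(X) = \lim_{k\to\infty} \frac{1}{k^d}\log \#\{x|_{F_k} : x \in X\}.$$ Also, $\log^+(x) = \max(0,\log(x))$. *)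

theory Defs
  imports "HOL-Probability.Probability" "HOL-Analysis.Finite_Cartesian_Product"
begin

text \<open>The lattice of dimension \<open>d = CARD('d)\<close> is the type \<^typ>\<open>int ^ 'd\<close>; since types are
  nonempty, \<open>d \<ge> 1\<close> holds automatically.\<close>

definition cube :: "nat \<Rightarrow> (int ^ 'd) set" where
  "cube n = {v. \<forall>i. v $ i \<in> {1..int n}}"

definition patterns :: "'a set \<Rightarrow> nat \<Rightarrow> (int ^ 'd \<Rightarrow> 'a) set" where
  "patterns A n = cube n \<rightarrow>\<^sub>E A"

text \<open>The pattern of \<open>x\<close> on \<open>cube n + p\<close>, translated back to \<open>cube n\<close>; this implements the
  identification of patterns up to translation.\<close>

definition pattern_at :: "nat \<Rightarrow> (int ^ 'd \<Rightarrow> 'a) \<Rightarrow> int ^ 'd \<Rightarrow> (int ^ 'd \<Rightarrow> 'a)" where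
  "pattern_at n x p = restrict (\<lambda>v. x (v + p)) (cube n)"

definition sft :: "'a set \<Rightarrow> nat \<Rightarrow> (int ^ 'd \<Rightarrow> 'a) set \<Rightarrow> (int ^ 'd \<Rightarrow> 'a) set" where
  "sft A n \<omega> = {x \<in> UNIV \<rightarrow> A. \<forall>p. pattern_at n x p \<in> \<omega>}"

text \<open>Because \<open>ln 0 = 0\<close>, the empty shift has entropy \<open>0\<close>. This is the convention the theorem
  needs: when \<open>\<alpha> * card A < 1\<close>, the random shift may be empty with non-negligible probability.\<close>

definition entropy :: "(int ^ 'd \<Rightarrow> 'a) set \<Rightarrow> real" where
  "entropy X = lim (\<lambda>k. 1 / real k ^ CARD('d) *
     ln (real (card ((\<lambda>x. restrict x (cube k)) ` X))))"

definition random_patterns :: "'a set \<Rightarrow> nat \<Rightarrow> real \<Rightarrow> (int ^ 'd \<Rightarrow> 'a) set pmf" where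
  "random_patterns A n \<alpha> =
     map_pmf (\<lambda>b. {u \<in> patterns A n. b u})
       (Pi_pmf (patterns A n) False (\<lambda>_. bernoulli_pmf \<alpha>))"

text \<open>For \<open>x = 0\<close> the value is \<open>0\<close>, as with the convention \<open>log 0 = -\<infinity>\<close>.\<close>

definition log_plus :: "real \<Rightarrow> real" where
  "log_plus x = max 0 (ln x)"

end

theory Submission
  imports Defs "HOL-Real_Asymp.Real_Asymp"
begin

text \<open>Take \<open>k = C n\<close> with a large constant \<open>C\<close>. Everything rests on one counting principle. If the
  windows of a pattern on \<open>cube k\<close> at the positions in a set \<open>P\<close> are copies of known windows, then
  keeping one position of \<open>P\<close> per cell of side \<open>n / 2\<close> leaves boundedly many windows which still
  cover \<open>card P\<close> sites, and at least \<open>n\<^sup>d\<close> if \<open>P\<close> is nonempty. The pattern is determined by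
  the uncovered sites and further data with polynomially many values.

  Upper bound: patterns on \<open>cube k\<close> with \<open>j\<close> distinct windows are essentially determined by \<open>j\<close>
  sites, so the expected number of patterns admitted by \<open>\<omega>\<close> is at most
  \<open>exp (k\<^sup>d (log\<^sup>+ (\<alpha> |A|) + \<epsilon> / 2))\<close>; Markov's inequality applies, as the entropy is the
  infimum of \<open>k\<^sup>-\<^sup>d log\<close> of the number of patterns on \<open>cube k\<close>.

  Lower bound, for \<open>\<alpha> |A| > 1\<close>: count the \<open>k\<close>-periodic configurations that have \<open>k\<^sup>d\<close> distinct
  windows, all of them in \<open>\<omega>\<close>. Two such configurations are correlated only if they share a window,
  which costs \<open>n\<^sup>d\<close> sites, so Chebyshev's inequality gives an error of order \<open>(\<alpha> |A|)\<close> to the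
  power \<open>- n\<^sup>d\<close>, up to a polynomial factor. By pigeonhole many of the admitted configurations agree
  on a frame of width \<open>n - 1\<close>, and these can be tiled independently of each other.\<close>

section \<open>Covering repeated windows\<close>

text \<open>Offsets start at 0 and sites at 1, so the window at offset \<open>p\<close> fills the
  sites \<open>p + v\<close> with \<open>v\<close> in \<open>cube n\<close>, and offset 0 gives
  \<open>cube n\<close> itself. The same set also indexes cells and tiles.\<close>

definition cube0 :: "nat \<Rightarrow> (int ^ 'd) set" where
  "cube0 k = {v. \<forall>i. v $ i \<in> {0..<int k}}"

definition wrap :: "nat \<Rightarrow> int ^ 'd \<Rightarrow> int ^ 'd" where
  "wrap k z = (\<chi> i. (z $ i - 1) mod int k + 1)"

definition periodic_ext :: "nat \<Rightarrow> (int ^ 'd \<Rightarrow> 'a) \<Rightarrow> int ^ 'd \<Rightarrow> 'a" where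
  "periodic_ext k u z = u (wrap k z)"

text \<open>Sites are wrapped so that one notion serves windows on the torus and, at offsets in
  \<open>cube0 (k - n + 1)\<close>, windows that stay inside \<open>cube k\<close>.\<close>

definition covered :: "nat \<Rightarrow> nat \<Rightarrow> (int ^ 'd) set \<Rightarrow> (int ^ 'd) set" where
  "covered k n S = (\<Union>p\<in>S. (\<lambda>v. wrap k (p + v)) ` cube n)"

lemma
  fixes S :: "'b set"
  assumes "finite S"
  shows finite_vec_set: "finite {v :: 'b ^ 'd. \<forall>i. v $ i \<in> S}"
    and card_vec_set: "card {v :: 'b ^ 'd. \<forall>i. v $ i \<in> S} = card S ^ CARD('d)"
proof -
  have b: "bij_betw vec_lambda (UNIV \<rightarrow>\<^sub>E S) {v :: 'b ^ 'd. \<forall>i. v $ i \<in> S}"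
    by (rule bij_betw_byWitness[where f' = vec_nth]) auto
  have "finite ((UNIV :: 'd set) \<rightarrow>\<^sub>E S)"
    using assms by (intro finite_PiE) auto
  with b show "finite {v :: 'b ^ 'd. \<forall>i. v $ i \<in> S}"
    using bij_betw_finite by blast
  show "card {v :: 'b ^ 'd. \<forall>i. v $ i \<in> S} = card S ^ CARD('d)"
    using bij_betw_same_card[OF b] by (simp add: card_PiE)
qed

lemma finite_cube [simp]: "finite (cube n :: (int ^ 'd) set)"
  and card_cube [simp]: "card (cube n :: (int ^ 'd) set) = n ^ CARD('d)"
  unfolding cube_def by (simp_all only: finite_vec_set card_vec_set finite_atLeastAtMost_int) simp

lemma finite_cube0 [simp]: "finite (cube0 n :: (int ^ 'd) set)"
  and card_cube0 [simp]: "card (cube0 n :: (int ^ 'd) set) = n ^ CARD('d)"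
  unfolding cube0_def by (simp_all only: finite_vec_set card_vec_set finite_atLeastLessThan_int) simp

lemma finite_patterns [simp]: "finite A \<Longrightarrow> finite (patterns A n :: (int ^ 'd \<Rightarrow> 'a) set)"
  unfolding patterns_def by (intro finite_PiE) auto

lemma card_patterns: "card (patterns A n :: (int ^ 'd \<Rightarrow> 'a) set) = card A ^ (n ^ CARD('d))"
  unfolding patterns_def by (simp add: card_PiE)

lemma wrap_in_cube:
  assumes "0 < k" shows "wrap k z \<in> cube k"
proof -
  have "0 \<le> (z $ i - 1) mod int k" "(z $ i - 1) mod int k < int k" for i
    using assms by auto
  then show ?thesis by (simp add: wrap_def cube_def add.commute zle_add1_eq_le[symmetric])
qed

lemma wrap_id:
  assumes "z \<in> cube k" shows "wrap k z = z"
proof -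
  have "(z $ i - 1) mod int k = z $ i - 1" for i
  proof (rule mod_pos_pos_trivial)
    have "1 \<le> z $ i" "z $ i \<le> int k" using assms by (auto simp: cube_def)
    then show "0 \<le> z $ i - 1" "z $ i - 1 < int k" by auto
  qed
  then show ?thesis by (simp add: wrap_def vec_eq_iff)
qed

lemma wrap_eq_iff: "wrap k x = wrap k y \<longleftrightarrow> (\<forall>i. int k dvd x $ i - y $ i)"
proof -
  have "(a - 1) mod int k + 1 = (b - 1) mod int k + 1 \<longleftrightarrow> int k dvd a - b" for a b
    by (simp add: mod_eq_dvd_iff)
  then show ?thesis by (simp add: wrap_def vec_eq_iff)
qed

lemma wrap_inj:
  assumes "wrap k x = wrap k y" "\<And>i. \<bar>x $ i - y $ i\<bar> < int k"
  shows "x = y"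
proof -
  have "x $ i - y $ i = 0" for i
  proof (rule ccontr)
    assume "x $ i - y $ i \<noteq> 0"
    moreover have "int k dvd x $ i - y $ i" using assms(1) by (simp add: wrap_eq_iff)
    ultimately have "\<bar>int k\<bar> \<le> \<bar>x $ i - y $ i\<bar>" by (rule dvd_imp_le_int)
    with assms(2)[of i] show False by simp
  qed
  then show ?thesis by (simp add: vec_eq_iff)
qed

lemma inj_on_wrap_cube0: "inj_on (\<lambda>p. wrap k (p + c)) (cube0 k)"
proof (rule inj_onI)
  fix p q assume "p \<in> cube0 k" "q \<in> cube0 k" and eq: "wrap k (p + c) = wrap k (q + c)"
  have "p + c = q + c"
  proof (rule wrap_inj[OF eq])
    fix i
    have "0 \<le> p $ i" "p $ i < int k" "0 \<le> q $ i" "q $ i < int k"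
      using \<open>p \<in> cube0 k\<close> \<open>q \<in> cube0 k\<close> by (auto simp: cube0_def)
    then show "\<bar>(p + c) $ i - (q + c) $ i\<bar> < int k" by simp
  qed
  then show "p = q" by simp
qed

lemma inj_on_wrap_cube:
  assumes "n \<le> k" shows "inj_on (\<lambda>v. wrap k (p + v)) (cube n)"
proof (rule inj_onI)
  fix v w assume "v \<in> cube n" "w \<in> cube n" and eq: "wrap k (p + v) = wrap k (p + w)"
  have "p + v = p + w"
  proof (rule wrap_inj[OF eq])
    fix i
    have "1 \<le> v $ i" "v $ i \<le> int n" "1 \<le> w $ i" "w $ i \<le> int n"
      using \<open>v \<in> cube n\<close> \<open>w \<in> cube n\<close> by (auto simp: cube_def)
    with assms show "\<bar>(p + v) $ i - (p + w) $ i\<bar> < int k" by simp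
  qed
  then show "v = w" by simp
qed

lemma covered_subset: "0 < k \<Longrightarrow> covered k n S \<subseteq> cube k"
  by (auto simp: covered_def wrap_in_cube)

text \<open>Restriction to \<open>D - U\<close> is injective on \<open>F\<close>. This turns sites
  that can be reconstructed from the others into savings in the exponent.\<close>

lemma card_determined:
  assumes "finite D" "finite A" "A \<noteq> {}" "F \<subseteq> D \<rightarrow>\<^sub>E A" "U \<subseteq> D" "r \<le> card U"
    and det: "\<And>u v. u \<in> F \<Longrightarrow> v \<in> F \<Longrightarrow> (\<And>z. z \<in> D - U \<Longrightarrow> u z = v z) \<Longrightarrow> u = v"
  shows "card F \<le> card A ^ (card D - r)"
proof -
  have "inj_on (\<lambda>u. restrict u (D - U)) F"
    by (rule inj_onI, rule det) (simp_all, metis Diff_iff restrict_apply')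
  then have "card F = card ((\<lambda>u. restrict u (D - U)) ` F)"
    by (simp add: card_image)
  also have "\<dots> \<le> card ((D - U) \<rightarrow>\<^sub>E A)"
  proof (intro card_mono finite_PiE)
    show "(\<lambda>u. restrict u (D - U)) ` F \<subseteq> (D - U) \<rightarrow>\<^sub>E A"
      using assms(4) by (force simp: PiE_iff)
  qed (use assms in auto)
  also have "\<dots> = card A ^ (card D - card U)"
    using assms by (simp add: card_PiE card_Diff_subset finite_subset)
  also have "\<dots> \<le> card A ^ (card D - r)"
    using assms by (intro power_increasing) (auto simp: Suc_le_eq card_gt_0_iff)
  finally show ?thesis .
qed

text \<open>Read \<open>\<theta> u p q\<close> as: the position \<open>q\<close> tells how to recover the window of \<open>u\<close> at \<open>p\<close>. The set
  \<open>R\<close> below collects one such pair for each cell of side \<open>m\<close> met by \<open>P u\<close>.\<close>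

lemma card_by_selection:
  fixes F :: "(int ^ 'd \<Rightarrow> 'a) set" and \<theta> :: "(int ^ 'd \<Rightarrow> 'a) \<Rightarrow> int ^ 'd \<Rightarrow> int ^ 'd \<Rightarrow> bool"
  assumes A: "finite A" "A \<noteq> {}" and F: "F \<subseteq> patterns A k"
    and m: "0 < m" "2 * m \<le> n" "n \<le> k"
    and P: "\<And>u. u \<in> F \<Longrightarrow> P u \<subseteq> cube0 k"
    and \<theta>: "\<And>u p. u \<in> F \<Longrightarrow> p \<in> P u \<Longrightarrow> \<exists>q\<in>cube0 k. \<theta> u p q"
    and r: "\<And>u. u \<in> F \<Longrightarrow> r \<le> card (P u) \<or> P u \<noteq> {} \<and> r \<le> n ^ CARD('d)"
    and det: "\<And>R u v. u \<in> F \<Longrightarrow> v \<in> F \<Longrightarrow>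
      (\<And>p q. (p, q) \<in> R \<Longrightarrow> p \<in> P u \<and> p \<in> P v \<and> \<theta> u p q \<and> \<theta> v p q) \<Longrightarrow>
      (\<And>z. z \<in> cube k \<Longrightarrow> z \<notin> covered k n (fst ` R) \<Longrightarrow> u z = v z) \<Longrightarrow> u = v"
  shows "card F \<le> (k ^ (2 * CARD('d)) + 1) ^ ((k div m + 1) ^ CARD('d)) * card A ^ (k ^ CARD('d) - r)"
proof -
  define cell :: "int ^ 'd \<Rightarrow> int ^ 'd" where "cell p = (\<chi> i. p $ i div int m)" for p
  define B :: "(int ^ 'd) set" where "B = cube0 (k div m + 1)"
  define T :: "((int ^ 'd) \<times> (int ^ 'd)) set" where "T = cube0 k \<times> cube0 k"
  define ok where "ok u c t \<longleftrightarrow> fst t \<in> P u \<and> cell (fst t) = c \<and> snd t \<in> cube0 k \<and> \<theta> u (fst t) (snd t)"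
    for u c t
  \<comment> \<open>The selection \<open>\<sigma> u\<close> is the extra data beside the uncovered
    sites: at most one pair per cell, and \<open>None\<close> on cells that \<open>P u\<close>
    misses. Patterns are counted separately for each value of the selection.\<close>
  define \<sigma> where "\<sigma> u = (\<lambda>c\<in>B. if \<exists>t. ok u c t then Some (SOME t. ok u c t) else None)" for u
  define R where "R u = {t. \<exists>c\<in>B. \<sigma> u c = Some t}" for u
  have k: "0 < k" using m by linarith
  have \<sigma>_ok: "ok u c t" if "c \<in> B" "\<sigma> u c = Some t" for u c t
  proof (cases "\<exists>t. ok u c t")
    case True
    then have "ok u c (SOME t. ok u c t)" by (rule someI_ex)
    moreover have "t = (SOME t. ok u c t)" using that True by (simp add: \<sigma>_def del: split_paired_Ex)
    ultimately show ?thesis by simp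
  next
    case False
    with that show ?thesis by (simp add: \<sigma>_def del: split_paired_Ex)
  qed
  have cell_B: "cell p \<in> B" if "p \<in> cube0 k" for p
  proof -
    have "0 \<le> p $ i div int m" "p $ i div int m < int (k div m + 1)" for i
    proof -
      have "0 \<le> p $ i" "p $ i < int k" using that by (auto simp: cube0_def)
      then have "0 \<le> p $ i div int m" "p $ i div int m \<le> int k div int m"
        using m(1) by (auto simp: pos_imp_zdiv_nonneg_iff intro: zdiv_mono1)
      then show "0 \<le> p $ i div int m" "p $ i div int m < int (k div m + 1)"
        by (auto simp: zdiv_int)
    qed
    then show ?thesis by (simp add: cell_def B_def cube0_def)
  qed
  have \<sigma>_in: "\<sigma> u \<in> B \<rightarrow>\<^sub>E insert None (Some ` T)" if "u \<in> F" for u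
  proof (rule PiE_I)
    fix c assume "c \<in> B"
    show "\<sigma> u c \<in> insert None (Some ` T)"
    proof (cases "\<sigma> u c")
      case (Some t)
      with \<sigma>_ok[OF \<open>c \<in> B\<close> Some] P[OF that] show ?thesis
        by (auto simp: ok_def T_def mem_Times_iff)
    qed simp
  qed (simp add: \<sigma>_def)
  have rep: "\<exists>p0 q0. (p0, q0) \<in> R u \<and> cell p0 = cell p" if "u \<in> F" "p \<in> P u" for u p
  proof -
    obtain q where "q \<in> cube0 k" "\<theta> u p q" using \<theta> \<open>u \<in> F\<close> \<open>p \<in> P u\<close> by blast
    then have ex: "ok u (cell p) (p, q)" using that by (simp add: ok_def)
    have cB: "cell p \<in> B" using P that cell_B by blast
    have "\<exists>t. ok u (cell p) t" using ex by blast
    then obtain t where t: "\<sigma> u (cell p) = Some t"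
      using cB by (simp add: \<sigma>_def del: split_paired_Ex)
    with cB \<sigma>_ok have "t \<in> R u" "cell (fst t) = cell p" unfolding R_def ok_def by blast+
    then show ?thesis by (metis prod.collapse)
  qed
  have covered_ge: "r \<le> card (covered k n (fst ` R u))" if "u \<in> F" for u
  proof -
    have fin: "finite (covered k n (fst ` R u))"
      using covered_subset[OF k] finite_cube finite_subset by metis
    consider "r \<le> card (P u)" | "P u \<noteq> {}" "r \<le> n ^ CARD('d)" using r \<open>u \<in> F\<close> by blast
    then show ?thesis
    proof cases
      case 1
      \<comment> \<open>The shift by \<open>m\<close> moves \<open>p\<close> into the window at every position in the cell of \<open>p\<close>.\<close>
      define f where "f p = wrap k (p + (\<chi> i. int m))" for p :: "int ^ 'd"
      have "f p \<in> covered k n (fst ` R u)" if pP: "p \<in> P u" for p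
      proof -
        obtain p0 q0 where R0: "(p0, q0) \<in> R u" "cell p0 = cell p" using rep[OF \<open>u \<in> F\<close> pP] by blast
        define v where "v = p + (\<chi> i. int m) - p0"
        have "v $ i \<in> {1..int n}" for i
        proof -
          have "p0 $ i div int m = p $ i div int m" using R0(2) by (simp add: cell_def vec_eq_iff)
          moreover have "0 \<le> p $ i mod int m" "p $ i mod int m < int m"
            "0 \<le> p0 $ i mod int m" "p0 $ i mod int m < int m" using m(1) by auto
          ultimately have "\<bar>p $ i - p0 $ i\<bar> < int m"
            using mult_div_mod_eq[of "int m" "p $ i"] mult_div_mod_eq[of "int m" "p0 $ i"]
            by (smt (verit))
          then show ?thesis using m by (auto simp: v_def)
        qed
        then have "v \<in> cube n" by (simp add: cube_def)
        moreover have "f p = wrap k (p0 + v)" by (simp add: f_def v_def)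
        ultimately show ?thesis using R0(1) unfolding covered_def by force
      qed
      moreover have "inj_on f (P u)"
        using inj_on_wrap_cube0 P[OF \<open>u \<in> F\<close>] unfolding f_def by (rule inj_on_subset)
      ultimately have "card (P u) \<le> card (covered k n (fst ` R u))"
        by (intro card_inj_on_le[OF _ _ fin]) auto
      with 1 show ?thesis by simp
    next
      case 2
      \<comment> \<open>One selected window is enough here: since \<open>n \<le> k\<close>, it does
        not overlap itself on the torus and covers \<open>n ^ CARD('d)\<close> distinct
        sites.\<close>
      then obtain p0 q0 where "(p0, q0) \<in> R u" using rep \<open>u \<in> F\<close> by blast
      then have "(\<lambda>v. wrap k (p0 + v)) ` cube n \<subseteq> covered k n (fst ` R u)"
        unfolding covered_def by force
      then have "card ((\<lambda>v. wrap k (p0 + v)) ` cube n) \<le> card (covered k n (fst ` R u))"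
        by (intro card_mono fin)
      with 2(2) show ?thesis by (simp add: card_image inj_on_wrap_cube m)
    qed
  qed
  \<comment> \<open>\<open>R u\<close> depends on \<open>u\<close> only through
    \<open>\<sigma> u\<close>, so all patterns with selection \<open>\<tau>\<close> share one
    covered set, whose sites \<open>det\<close> recovers.\<close>
  have one: "card {u \<in> F. \<sigma> u = \<tau>} \<le> card A ^ (k ^ CARD('d) - r)" for \<tau>
  proof (cases "\<exists>u0\<in>F. \<sigma> u0 = \<tau>")
    case True
    then obtain u0 where u0: "u0 \<in> F" "\<sigma> u0 = \<tau>" by blast
    have "card {u \<in> F. \<sigma> u = \<tau>} \<le> card A ^ (card (cube k :: (int ^ 'd) set) - r)"
    proof (rule card_determined[where U = "covered k n (fst ` R u0)"])
      fix u v assume u: "u \<in> {u \<in> F. \<sigma> u = \<tau>}" and v: "v \<in> {u \<in> F. \<sigma> u = \<tau>}"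
        and eq: "\<And>z. z \<in> cube k - covered k n (fst ` R u0) \<Longrightarrow> u z = v z"
      show "u = v"
      proof (rule det[where R = "R u0"])
        fix p q assume "(p, q) \<in> R u0"
        then obtain c where "c \<in> B" "\<tau> c = Some (p, q)" unfolding R_def u0 by blast
        then show "p \<in> P u \<and> p \<in> P v \<and> \<theta> u p q \<and> \<theta> v p q"
          using \<sigma>_ok[of c u] \<sigma>_ok[of c v] u v by (auto simp: ok_def)
      qed (use u v eq in auto)
    next
      show "{u \<in> F. \<sigma> u = \<tau>} \<subseteq> cube k \<rightarrow>\<^sub>E A"
        using F unfolding patterns_def by blast
    qed (use A u0 covered_ge covered_subset[OF k] in auto)
    then show ?thesis by simp
  next
    case False
    then have "{u \<in> F. \<sigma> u = \<tau>} = {}" by blast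
    then show ?thesis by (simp only: card.empty le0)
  qed
  define Sg where "Sg = B \<rightarrow>\<^sub>E insert None (Some ` T)"
  have finS: "finite Sg"
    unfolding Sg_def B_def T_def by (intro finite_PiE) auto
  \<comment> \<open>The additional 1 counts \<open>None\<close>.\<close>
  have "card (insert None (Some ` T)) = card T + 1"
    by (subst card_insert_disjoint) (auto simp: T_def card_image)
  then have cardS: "card Sg = (k ^ (2 * CARD('d)) + 1) ^ ((k div m + 1) ^ CARD('d))"
    unfolding Sg_def by (simp add: card_PiE B_def T_def card_cartesian_product power_add mult_2)
  have "F = (\<Union>\<tau>\<in>Sg. {u \<in> F. \<sigma> u = \<tau>})"
    using \<sigma>_in unfolding Sg_def by blast
  then have "card F \<le> (\<Sum>\<tau>\<in>Sg. card {u \<in> F. \<sigma> u = \<tau>})"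
    using card_UN_le[OF finS, of "\<lambda>\<tau>. {u \<in> F. \<sigma> u = \<tau>}"] by simp
  also have "\<dots> \<le> card Sg * card A ^ (k ^ CARD('d) - r)"
    using sum_bounded_above[of Sg "\<lambda>\<tau>. card {u \<in> F. \<sigma> u = \<tau>}"] one by simp
  finally show ?thesis unfolding cardS .
qed

section \<open>Entropy of shift-invariant sets\<close>

abbreviation lang :: "nat \<Rightarrow> (int ^ 'd \<Rightarrow> 'a) set \<Rightarrow> (int ^ 'd \<Rightarrow> 'a) set" where
  "lang k X \<equiv> (\<lambda>x. restrict x (cube k)) ` X"

definition shift_inv :: "(int ^ 'd \<Rightarrow> 'a) set \<Rightarrow> bool" where
  "shift_inv X \<longleftrightarrow> (\<forall>x\<in>X. \<forall>p. (\<lambda>v. x (v + p)) \<in> X)"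

text \<open>The quotient belonging to the remainder \<open>wrap\<close>: the index of the tile of
  side \<open>k\<close> that contains \<open>z\<close>, where index 0 is
  \<open>cube k\<close>.\<close>

definition block :: "nat \<Rightarrow> int ^ 'd \<Rightarrow> int ^ 'd" where
  "block k z = (\<chi> i. (z $ i - 1) div int k)"

lemma wrap_plus_block: "wrap k z + (\<chi> i. int k * block k z $ i) = z"
proof -
  have "(z $ i - 1) mod int k + 1 + int k * ((z $ i - 1) div int k) = z $ i" for i
    using mult_div_mod_eq[of "int k" "z $ i - 1"] by linarith
  then show ?thesis
    unfolding wrap_def block_def vec_eq_iff by (simp only: vector_add_component vec_lambda_beta) blast
qed

lemma block_in_cube0:
  assumes "z \<in> cube k" "k \<le> q * m" "0 < m"
  shows "block m z \<in> cube0 q"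
proof -
  have "block m z $ i \<in> {0..<int q}" for i
  proof -
    have "1 \<le> z $ i" "z $ i \<le> int k" using assms(1) by (auto simp: cube_def)
    then have "0 \<le> z $ i - 1" "z $ i - 1 < int q * int m"
      using assms(2) by (auto simp flip: of_nat_mult)
    moreover have "(z $ i - 1) div int m * int m \<le> z $ i - 1"
      using assms(3) div_mult_mod_eq[of "z $ i - 1" "int m"] pos_mod_sign[of "int m" "z $ i - 1"] by linarith
    ultimately have "(z $ i - 1) div int m * int m < int q * int m" "0 \<le> z $ i - 1"
      by linarith+
    then show ?thesis
      using assms(3) unfolding block_def mult_less_cancel_right
      by (simp add: pos_imp_zdiv_nonneg_iff)
  qed
  then show ?thesis by (simp add: cube0_def)
qed

lemma lang_subset: "X \<subseteq> UNIV \<rightarrow> A \<Longrightarrow> lang k X \<subseteq> patterns A k"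
  by (fastforce simp: patterns_def)

lemma finite_lang: "X \<subseteq> UNIV \<rightarrow> A \<Longrightarrow> finite A \<Longrightarrow> finite (lang k X)"
  by (rule finite_subset[OF lang_subset finite_patterns])

text \<open>Submultiplicativity: \<open>q ^ CARD('d)\<close> translates of \<open>cube m\<close>
  cover \<open>cube k\<close>, and by shift invariance each of them carries an element of
  \<open>lang m X\<close>.\<close>

lemma card_lang_le_power:
  fixes X :: "(int ^ 'd \<Rightarrow> 'a) set"
  assumes X: "X \<subseteq> UNIV \<rightarrow> A" "finite A" "shift_inv X" and "k \<le> q * m" "0 < m"
  shows "card (lang k X) \<le> card (lang m X) ^ (q ^ CARD('d))"
proof -
  define f where "f g = restrict (\<lambda>z. g (block m z) (wrap m z)) (cube k)"
    for g :: "int ^ 'd \<Rightarrow> int ^ 'd \<Rightarrow> 'a"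
  let ?S = "(cube0 q :: (int ^ 'd) set) \<rightarrow>\<^sub>E lang m X"
  have fin: "finite ?S" using finite_lang[OF X(1,2)] by (intro finite_PiE) auto
  have "lang k X \<subseteq> f ` ?S"
  proof (rule image_subsetI)
    fix x assume "x \<in> X"
    define g where "g = (\<lambda>b\<in>cube0 q. restrict (\<lambda>v. x (v + (\<chi> i. int m * b $ i))) (cube m))"
    have "g \<in> ?S"
      using X(3) \<open>x \<in> X\<close> by (auto simp: g_def shift_inv_def)
    moreover have "restrict x (cube k) = f g"
    proof
      fix z
      show "restrict x (cube k) z = f g z"
        using block_in_cube0[OF _ assms(4,5), of z] wrap_in_cube[OF assms(5), of z] wrap_plus_block[of m z]
        by (cases "z \<in> cube k") (auto simp: f_def g_def)
    qed
    ultimately show "restrict x (cube k) \<in> f ` ?S" by blast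
  qed
  then have "card (lang k X) \<le> card ?S"
    using fin by (meson card_image_le card_mono finite_imageI le_trans)
  then show ?thesis by (simp add: card_PiE)
qed

definition lang_rate :: "(int ^ 'd \<Rightarrow> 'a) set \<Rightarrow> nat \<Rightarrow> real" where
  "lang_rate X k = 1 / real k ^ CARD('d) * ln (real (card (lang k X)))"

lemma lang_rate_nonneg: 
  assumes "X \<subseteq> UNIV \<rightarrow> A" "finite A"
  shows "0 \<le> lang_rate X k"
proof (cases "card (lang k X) = 0")
  case False
  then have "1 \<le> real (card (lang k X))" by linarith
  then show ?thesis unfolding lang_rate_def by (intro mult_nonneg_nonneg ln_ge_zero) simp_all
next
  case True
  then show ?thesis by (simp only: lang_rate_def True) simp
qed

text \<open>At most \<open>k div m + 1\<close> tiles of side \<open>m\<close> are used in each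
  direction. As \<open>k\<close> grows, the right-hand side tends to
  \<open>lang_rate X m\<close>.\<close>

lemma lang_rate_le:
  fixes X :: "(int ^ 'd \<Rightarrow> 'a) set"
  assumes X: "X \<subseteq> UNIV \<rightarrow> A" "finite A" "shift_inv X" "X \<noteq> {}" and "0 < m" "0 < k"
  shows "lang_rate X k \<le> (1 / real m + 1 / real k) ^ CARD('d) * ln (real (card (lang m X)))"
proof -
  let ?q = "k div m + 1"
  have pos: "0 < card (lang j X)" for j
    using finite_lang[OF X(1,2)] X(4) by (simp add: card_gt_0_iff)
  have "k \<le> ?q * m"
    using div_mult_mod_eq[of k m] mod_less_divisor[OF \<open>0 < m\<close>, of k] unfolding add_mult_distrib by linarith
  from card_lang_le_power[OF X(1-3) this \<open>0 < m\<close>]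
  have "real (card (lang k X)) \<le> real (card (lang m X)) ^ (?q ^ CARD('d))"
    unfolding of_nat_power[symmetric] of_nat_le_iff .
  then have "ln (real (card (lang k X))) \<le> ln (real (card (lang m X)) ^ (?q ^ CARD('d)))"
    using pos by (subst ln_le_cancel_iff) auto
  also have "\<dots> = real ?q ^ CARD('d) * ln (real (card (lang m X)))"
    using pos by (subst ln_realpow) auto
  finally have "lang_rate X k \<le> 1 / real k ^ CARD('d) * (real ?q ^ CARD('d) * ln (real (card (lang m X))))"
    unfolding lang_rate_def by (intro mult_left_mono) simp_all
  also have "\<dots> = (real ?q / real k) ^ CARD('d) * ln (real (card (lang m X)))"
    by (simp add: power_divide)
  also have "\<dots> \<le> (1 / real m + 1 / real k) ^ CARD('d) * ln (real (card (lang m X)))"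
  proof (intro mult_right_mono power_mono)
    have "real (k div m) \<le> real k / real m" by (rule of_nat_div_le_of_nat)
    then show "real ?q / real k \<le> 1 / real m + 1 / real k"
      using assms(5,6) by (simp add: field_simps)
    show "0 \<le> ln (real (card (lang m X)))" using pos[of m] by (intro ln_ge_zero) linarith
  qed simp
  finally show ?thesis .
qed

text \<open>Fekete's argument on cubes: by \<open>lang_rate_le\<close> the limit superior is at most
  every \<open>lang_rate X m\<close>, so the sequence converges to its infimum. Only this
  convergence gives \<open>lim\<close> in \<open>entropy\<close> its meaning.\<close>

lemma
  fixes X :: "(int ^ 'd \<Rightarrow> 'a) set"
  assumes X: "X \<subseteq> UNIV \<rightarrow> A" "finite A" "shift_inv X"
  shows lang_rate_tendsto: "lang_rate X \<longlonglongrightarrow> entropy X"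
    and entropy_le_lang_rate: "0 < m \<Longrightarrow> entropy X \<le> lang_rate X m"
proof -
  have "lang_rate X \<longlonglongrightarrow> entropy X \<and> (\<forall>m>0. entropy X \<le> lang_rate X m)"
  proof (cases "X = {}")
    case True
    then have "lang_rate X = (\<lambda>_. 0)" by (simp add: lang_rate_def fun_eq_iff)
    moreover have "entropy X = 0"
      using limI[OF tendsto_const[of "0::real" sequentially]] by (simp add: entropy_def True)
    ultimately show ?thesis by simp
  next
    case False
    define I where "I = (INF m\<in>{0<..}. lang_rate X m)"
    have bdd: "bdd_below (lang_rate X ` {0<..})"
      using lang_rate_nonneg[OF X(1,2)] by (intro bdd_belowI2)
    have I_le: "I \<le> lang_rate X m" if "0 < m" for m
      unfolding I_def using that by (intro cINF_lower bdd) simp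
    have "lang_rate X \<longlonglongrightarrow> I"
    proof (rule order_tendstoI)
      fix a assume "a < I"
      then show "\<forall>\<^sub>F k in sequentially. a < lang_rate X k"
        using I_le by (intro eventually_sequentiallyI[of 1]) (simp add: less_le_trans[of a I])
    next
      fix a assume "I < a"
      then obtain m where m: "0 < m" "lang_rate X m < a"
        unfolding I_def by (subst (asm) cINF_less_iff[OF _ bdd]) auto
      have "(\<lambda>k. (1 / real m + 1 / real k) ^ CARD('d) * ln (real (card (lang m X))))
          \<longlonglongrightarrow> (1 / real m + 0) ^ CARD('d) * ln (real (card (lang m X)))"
        by (intro tendsto_intros lim_1_over_n)
      then have "(\<lambda>k. (1 / real m + 1 / real k) ^ CARD('d) * ln (real (card (lang m X))))
          \<longlonglongrightarrow> lang_rate X m"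
        by (simp add: lang_rate_def power_divide)
      from order_tendstoD(2)[OF this m(2)] eventually_gt_at_top[of 0]
      show "\<forall>\<^sub>F k in sequentially. lang_rate X k < a"
        by eventually_elim (rule le_less_trans[OF lang_rate_le[OF X False m(1)]])
    qed
    moreover from this have "entropy X = I"
      unfolding entropy_def lang_rate_def[abs_def] by (rule limI)
    ultimately show ?thesis using I_le by simp
  qed
  then show "lang_rate X \<longlonglongrightarrow> entropy X" "0 < m \<Longrightarrow> entropy X \<le> lang_rate X m" by blast+
qed

lemma entropy_nonneg:
  assumes "X \<subseteq> UNIV \<rightarrow> A" "finite A" "shift_inv X"
  shows "0 \<le> entropy X"
  using lang_rate_tendsto[OF assms] lang_rate_nonneg[OF assms(1,2)] by (intro LIMSEQ_le_const) auto

text \<open>As the limit exists, it can be taken along the multiples of \<open>k\<close>, where the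
  hypothesis bounds the rate below by a constant.\<close>

lemma entropy_ge:
  fixes X :: "(int ^ 'd \<Rightarrow> 'a) set"
  assumes X: "X \<subseteq> UNIV \<rightarrow> A" "finite A" "shift_inv X" and "0 < k" "0 < M"
    and M: "\<And>q. 0 < q \<Longrightarrow> M ^ (q ^ CARD('d)) \<le> card (lang (q * k) X)"
  shows "ln (real M) / real k ^ CARD('d) \<le> entropy X"
proof (rule LIMSEQ_le_const)
  have "strict_mono (\<lambda>q. Suc q * k)"
    using \<open>0 < k\<close> by (intro strict_monoI mult_strict_right_mono) auto
  from LIMSEQ_subseq_LIMSEQ[OF lang_rate_tendsto[OF X] this]
  show "(\<lambda>q. lang_rate X (Suc q * k)) \<longlonglongrightarrow> entropy X" by (simp add: o_def)
  have "ln (real M) / real k ^ CARD('d) \<le> lang_rate X (Suc q * k)" for q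
  proof -
    have "real M ^ (Suc q ^ CARD('d)) \<le> real (card (lang (Suc q * k) X))"
      using M[of "Suc q"] by (subst of_nat_power[symmetric], subst of_nat_le_iff) simp
    moreover have "0 < real M ^ (Suc q ^ CARD('d))" using \<open>0 < M\<close> by simp
    ultimately have "ln (real M ^ (Suc q ^ CARD('d))) \<le> ln (real (card (lang (Suc q * k) X)))"
      by (subst ln_le_cancel_iff) linarith+
    then have "real (Suc q) ^ CARD('d) * ln (real M) \<le> ln (real (card (lang (Suc q * k) X)))"
      using \<open>0 < M\<close> by (subst (asm) ln_realpow) auto
    then have "1 / real (Suc q * k) ^ CARD('d) * (real (Suc q) ^ CARD('d) * ln (real M))
        \<le> lang_rate X (Suc q * k)"
      unfolding lang_rate_def by (intro mult_left_mono) simp_all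
    then show ?thesis by (simp add: power_mult_distrib del: of_nat_Suc mult_Suc)
  qed
  then show "\<exists>N. \<forall>q\<ge>N. ln (real M) / real k ^ CARD('d) \<le> lang_rate X (Suc q * k)" by blast
qed

lemma sft_subset: "sft A n \<omega> \<subseteq> UNIV \<rightarrow> A"
  by (auto simp: sft_def)

lemma shift_inv_sft: "shift_inv (sft A n (\<omega> :: (int ^ 'd \<Rightarrow> 'a) set))"
proof -
  have "pattern_at n (\<lambda>v. x (v + p)) q = pattern_at n x (q + p)" for x :: "int ^ 'd \<Rightarrow> 'a" and p q
    by (simp add: pattern_at_def add.assoc)
  then show ?thesis by (simp add: shift_inv_def sft_def Pi_iff)
qed

section \<open>Moment bounds\<close>

context
  fixes A :: "'a set" and \<alpha> :: real and n :: nat and M :: "(int ^ 'd \<Rightarrow> 'a) set pmf"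
    and G :: "'b set" and W :: "'b \<Rightarrow> (int ^ 'd \<Rightarrow> 'a) set"
  assumes A: "finite A" and \<alpha>: "\<alpha> \<in> {0..1}"
    and M: "M = random_patterns A n \<alpha>"
    and G: "finite G" and W: "\<And>u. u \<in> G \<Longrightarrow> W u \<subseteq> patterns A n"
begin

text \<open>Independence: the event is a product set in the Bernoulli variables, with factor
  \<alpha> on \<open>U\<close> and 1 elsewhere.\<close>

lemma prob_superset:
  assumes "U \<subseteq> patterns A n"
  shows "measure_pmf.prob M {\<omega>. U \<subseteq> \<omega>} = \<alpha> ^ card U"
proof -
  let ?p = "patterns A n :: (int ^ 'd \<Rightarrow> 'a) set"
  let ?B = "\<lambda>x. if x \<in> U then {True} else UNIV"
  have "(\<lambda>b. {u \<in> ?p. b u}) -` {\<omega>. U \<subseteq> \<omega>} = Pi ?p ?B"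
    using assms by (auto simp: Pi_iff split: if_splits)
  then have "measure_pmf.prob M {\<omega>. U \<subseteq> \<omega>} = (\<Prod>x\<in>?p. measure_pmf.prob (bernoulli_pmf \<alpha>) (?B x))"
    unfolding M random_patterns_def measure_map_pmf using A by (simp add: measure_Pi_pmf_Pi)
  also have "\<dots> = (\<Prod>x\<in>?p. if x \<in> U then \<alpha> else 1)"
    using \<alpha> by (intro prod.cong) (auto simp: measure_pmf_single)
  also have "\<dots> = (\<Prod>x\<in>U. \<alpha>)"
    using A assms by (simp add: prod.If_cases Int_absorb1)
  finally show ?thesis by simp
qed

lemma integrable_M: "integrable M (f :: (int ^ 'd \<Rightarrow> 'a) set \<Rightarrow> real)"
proof (rule integrable_measure_pmf_finite)
  have "set_pmf M \<subseteq> Pow (patterns A n)" unfolding M random_patterns_def by auto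
  then show "finite (set_pmf M)" using A by (meson finite_Pow_iff finite_patterns finite_subset)
qed

lemma card_eq_sum_indicator:
  "real (card {u \<in> G. W u \<subseteq> \<omega>}) = (\<Sum>u\<in>G. indicator {\<omega>. W u \<subseteq> \<omega>} \<omega>)"
  using G by (simp add: indicator_def sum.If_cases Int_def)

lemma markov:
  assumes "\<And>\<omega>. 0 \<le> f \<omega>" "0 < t"
  shows "measure_pmf.prob M {\<omega>. t \<le> f \<omega>} \<le> measure_pmf.expectation M f / t"
  using integral_Markov_inequality_measure[OF integrable_M, of "UNIV" f t] assms by simp

lemma first_moment_bound:
  assumes "0 < t"
  shows "measure_pmf.prob M {\<omega>. t \<le> real (card {u \<in> G. W u \<subseteq> \<omega>})} \<le> (\<Sum>u\<in>G. \<alpha> ^ card (W u)) / t"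
proof -
  have "measure_pmf.expectation M (\<lambda>\<omega>. real (card {u \<in> G. W u \<subseteq> \<omega>}))
      = (\<Sum>u\<in>G. measure_pmf.prob M {\<omega>. W u \<subseteq> \<omega>})"
    unfolding card_eq_sum_indicator by (subst Bochner_Integration.integral_sum) (auto simp: integrable_M)
  also have "\<dots> = (\<Sum>u\<in>G. \<alpha> ^ card (W u))"
    by (intro sum.cong prob_superset W) auto
  finally show ?thesis using markov[of "\<lambda>\<omega>. real (card {u \<in> G. W u \<subseteq> \<omega>})" t] assms by simp
qed

text \<open>Chebyshev's inequality at half the mean. Pairs with disjoint window sets have covariance
  0; for the others, sharing windows raises the joint probability above the product by the factor
  \<open>(1 / \<alpha>) ^ card (W u \<inter> W v)\<close>.\<close>

lemma second_moment_bound: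
  assumes "0 < \<alpha>" "G \<noteq> {}" and N: "\<And>u. u \<in> G \<Longrightarrow> card (W u) = N"
  shows "measure_pmf.prob M {\<omega>. real (card {u \<in> G. W u \<subseteq> \<omega>}) \<le> real (card G) * \<alpha> ^ N / 2}
    \<le> 4 / real (card G) ^ 2 * (\<Sum>u\<in>G. \<Sum>v\<in>{v \<in> G. W u \<inter> W v \<noteq> {}}. (1 / \<alpha>) ^ card (W u \<inter> W v))"
proof -
  define Y where "Y \<omega> = real (card {u \<in> G. W u \<subseteq> \<omega>})" for \<omega>
  define \<mu> where "\<mu> = real (card G) * \<alpha> ^ N"
  define S where "S = (\<Sum>u\<in>G. \<Sum>v\<in>{v \<in> G. W u \<inter> W v \<noteq> {}}. (1 / \<alpha>) ^ card (W u \<inter> W v))"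
  have \<mu>: "0 < \<mu>" using assms G by (simp add: \<mu>_def card_gt_0_iff)
  have fin: "finite (W u)" if "u \<in> G" for u
    using W[OF that] A finite_subset finite_patterns by blast
  have EY: "measure_pmf.expectation M Y = \<mu>"
    unfolding Y_def card_eq_sum_indicator
    by (subst Bochner_Integration.integral_sum) (auto simp: integrable_M prob_superset W N \<mu>_def)
  have Y2: "(Y \<omega>)\<^sup>2 = (\<Sum>u\<in>G. \<Sum>v\<in>G. indicator {\<omega>. W u \<union> W v \<subseteq> \<omega>} \<omega>)" for \<omega>
    unfolding Y_def card_eq_sum_indicator power2_eq_square sum_product
    by (intro sum.cong) (auto simp: indicator_def)
  have EY2: "measure_pmf.expectation M (\<lambda>\<omega>. (Y \<omega>)\<^sup>2) = (\<Sum>u\<in>G. \<Sum>v\<in>G. \<alpha> ^ card (W u \<union> W v))"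
  proof -
    have "measure_pmf.expectation M (\<lambda>\<omega>. (Y \<omega>)\<^sup>2)
        = (\<Sum>u\<in>G. \<Sum>v\<in>G. measure_pmf.prob M {\<omega>. W u \<union> W v \<subseteq> \<omega>})"
      unfolding Y2
      by (subst Bochner_Integration.integral_sum, rule integrable_M, intro sum.cong refl)
        (subst Bochner_Integration.integral_sum, auto simp: integrable_M)
    also have "\<dots> = (\<Sum>u\<in>G. \<Sum>v\<in>G. \<alpha> ^ card (W u \<union> W v))"
      using W by (intro sum.cong prob_superset) auto
    finally show ?thesis .
  qed
  have "measure_pmf.expectation M (\<lambda>\<omega>. (Y \<omega> - \<mu>)\<^sup>2)
      = measure_pmf.expectation M (\<lambda>\<omega>. (Y \<omega>)\<^sup>2 - 2 * \<mu> * Y \<omega> + \<mu>\<^sup>2)"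
    by (simp add: power2_diff algebra_simps)
  also have "\<dots> = measure_pmf.expectation M (\<lambda>\<omega>. (Y \<omega>)\<^sup>2) - 2 * \<mu> * measure_pmf.expectation M Y + \<mu>\<^sup>2"
    by (simp add: integrable_M)
  also have "\<dots> = (\<Sum>u\<in>G. \<Sum>v\<in>G. \<alpha> ^ card (W u \<union> W v)) - \<mu>\<^sup>2"
    unfolding EY EY2 by (simp add: power2_eq_square)
  also have "\<mu>\<^sup>2 = (\<Sum>u\<in>G. \<Sum>v\<in>G. \<alpha> ^ (2 * N))"
    by (simp add: \<mu>_def power2_eq_square power_add mult_2 mult_2_right mult_ac)
  also have "(\<Sum>u\<in>G. \<Sum>v\<in>G. \<alpha> ^ card (W u \<union> W v)) - (\<Sum>u\<in>G. \<Sum>v\<in>G. \<alpha> ^ (2 * N))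
      = (\<Sum>u\<in>G. \<Sum>v\<in>G. \<alpha> ^ card (W u \<union> W v) - \<alpha> ^ (2 * N))"
    by (simp add: sum_subtractf)
  \<comment> \<open>For intersecting pairs the subtracted \<open>\<alpha> ^ (2 * N)\<close> is
    simply dropped.\<close>
  also have "\<dots> \<le> (\<Sum>u\<in>G. \<Sum>v\<in>G. if W u \<inter> W v \<noteq> {} then \<alpha> ^ (2 * N) * (1 / \<alpha>) ^ card (W u \<inter> W v) else 0)"
  proof (intro sum_mono)
    fix u v assume "u \<in> G" "v \<in> G"
    then have c: "card (W u \<union> W v) + card (W u \<inter> W v) = 2 * N"
      using card_Un_Int[OF fin fin, of u v] N by simp
    then have "\<alpha> ^ (2 * N) = \<alpha> ^ card (W u \<union> W v) * \<alpha> ^ card (W u \<inter> W v)"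
      by (simp flip: power_add)
    then have "\<alpha> ^ card (W u \<union> W v) = \<alpha> ^ (2 * N) * (1 / \<alpha>) ^ card (W u \<inter> W v)"
      using \<open>0 < \<alpha>\<close> by (simp add: power_one_over field_simps)
    moreover have "0 \<le> \<alpha> ^ (2 * N)" using \<open>0 < \<alpha>\<close> by simp
    moreover have "card (W u \<union> W v) = 2 * N" if "W u \<inter> W v = {}" using c that by simp
    ultimately show "\<alpha> ^ card (W u \<union> W v) - \<alpha> ^ (2 * N)
        \<le> (if W u \<inter> W v \<noteq> {} then \<alpha> ^ (2 * N) * (1 / \<alpha>) ^ card (W u \<inter> W v) else 0)"
      by (cases "W u \<inter> W v = {}") (simp_all only: if_True if_False, simp_all)
  qed
  also have "\<dots> = \<alpha> ^ (2 * N) * S"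
    unfolding S_def sum_distrib_left using G by (simp only: sum.inter_filter)
  finally have var: "measure_pmf.expectation M (\<lambda>\<omega>. (Y \<omega> - \<mu>)\<^sup>2) \<le> \<alpha> ^ (2 * N) * S" .
  have "measure_pmf.prob M {\<omega>. Y \<omega> \<le> \<mu> / 2} \<le> measure_pmf.prob M {\<omega>. (\<mu> / 2)\<^sup>2 \<le> (Y \<omega> - \<mu>)\<^sup>2}"
  proof (intro measure_pmf.finite_measure_mono subsetI CollectI; unfold mem_Collect_eq sets_measure_pmf)
    fix \<omega> assume "Y \<omega> \<le> \<mu> / 2"
    then have "(\<mu> / 2)\<^sup>2 \<le> (\<mu> - Y \<omega>)\<^sup>2" using \<mu> by (intro power_mono) auto
    then show "(\<mu> / 2)\<^sup>2 \<le> (Y \<omega> - \<mu>)\<^sup>2" by (simp add: power2_commute)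
  qed simp
  also have "\<dots> \<le> \<alpha> ^ (2 * N) * S / (\<mu> / 2)\<^sup>2"
    using markov[of "\<lambda>\<omega>. (Y \<omega> - \<mu>)\<^sup>2" "(\<mu> / 2)\<^sup>2"] \<mu> var
    by (intro order.trans[OF markov] divide_right_mono) auto
  also have "\<dots> = 4 / real (card G) ^ 2 * S"
    using \<open>0 < \<alpha>\<close> by (simp add: \<mu>_def power_mult_distrib power_divide power_mult power_even_eq field_simps)
  finally show ?thesis unfolding Y_def \<mu>_def S_def .
qed

end

section \<open>Counting patterns with repeated windows\<close>

text \<open>The functional \<open>z \<mapsto> \<Sum>i. w i * z $ i\<close> replaces the lexicographic order: it is compatible with
  translations and injective on a finite set of positions, so every repeated window has an earlier copy.\<close>

lemma exists_separating_weights: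
  fixes B :: "(int ^ 'd) set"
  assumes "finite B"
  shows "\<exists>w :: 'd \<Rightarrow> int. (\<forall>i. 0 \<le> w i) \<and> (\<forall>z\<in>B. (\<Sum>i\<in>UNIV. w i * z $ i) = 0 \<longrightarrow> z = 0)"
proof -
  have "\<exists>w :: 'd \<Rightarrow> int. (\<forall>i. 0 \<le> w i) \<and> (\<forall>z\<in>B. (\<Sum>i\<in>I. w i * z $ i) = 0 \<longrightarrow> (\<forall>i\<in>I. z $ i = 0))"
    if "finite I" for I
    using that
  proof (induction I rule: finite_induct)
    case empty
    then show ?case by (intro exI[of _ "\<lambda>_. 0"]) simp
  next
    case (insert j I)
    then obtain w :: "'d \<Rightarrow> int" where w: "\<And>i. 0 \<le> w i"
      "\<And>z. z \<in> B \<Longrightarrow> (\<Sum>i\<in>I. w i * z $ i) = 0 \<Longrightarrow> \<forall>i\<in>I. z $ i = 0"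
      by blast
    define s where "s z = (\<Sum>i\<in>I. w i * z $ i)" for z :: "int ^ 'd"
    \<comment> \<open>The new weight exceeds every \<open>\<bar>s z\<bar>\<close> on
      \<open>B\<close>, so \<open>c * z $ j\<close> can cancel \<open>s z\<close> only if
      \<open>z $ j = 0\<close>.\<close>
    define c where "c = 1 + (\<Sum>z\<in>B. \<bar>s z\<bar>)"
    have c: "\<bar>s z\<bar> < c" if "z \<in> B" for z
      using member_le_sum[of z B "\<lambda>z. \<bar>s z\<bar>"] that assms by (simp add: c_def)
    have "\<forall>i\<in>insert j I. z $ i = 0"
      if "z \<in> B" "(\<Sum>i\<in>insert j I. (w(j := c)) i * z $ i) = 0" for z
    proof -
      have "(\<Sum>i\<in>I. (w(j := c)) i * z $ i) = s z"
        unfolding s_def using insert.hyps by (intro sum.cong) auto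
      then have eq: "c * z $ j + s z = 0" using that(2) insert.hyps by simp
      have "z $ j = 0"
      proof (rule ccontr)
        assume "z $ j \<noteq> 0"
        then have "\<bar>c\<bar> * 1 \<le> \<bar>c\<bar> * \<bar>z $ j\<bar>" by (intro mult_left_mono) auto
        then have "\<bar>c\<bar> \<le> \<bar>c * z $ j\<bar>" by (simp add: abs_mult)
        with eq c[OF that(1)] show False by linarith
      qed
      moreover from this eq have "s z = 0" by simp
      ultimately show ?thesis using w(2)[OF that(1)] by (simp add: s_def)
    qed
    moreover have "0 \<le> c" by (simp add: c_def sum_nonneg)
    ultimately show ?case using w(1) by (intro exI[of _ "w(j := c)"]) (simp del: fun_upd_apply, simp)
  qed
  from this[of UNIV] show ?thesis by (simp add: vec_eq_iff)
qed

section \<open>Patterns with few distinct windows\<close>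

lemma patterns_eqI:
  assumes "u \<in> patterns A k" "v \<in> patterns A k" "\<And>z. z \<in> cube k \<Longrightarrow> u z = v z"
  shows "u = v"
  using assms unfolding patterns_def by (intro PiE_ext)

lemma pattern_at_in_patterns:
  assumes "x \<in> UNIV \<rightarrow> A"
  shows "pattern_at n x p \<in> patterns A n"
  using assms by (auto simp: pattern_at_def patterns_def)

lemma pattern_at_eqD:
  "pattern_at n x p = pattern_at n y q \<Longrightarrow> v \<in> cube n \<Longrightarrow> x (p + v) = y (q + v)"
  by (auto simp: pattern_at_def fun_eq_iff restrict_def add.commute split: if_splits)

lemma cube0_plus_cube:
  assumes "p \<in> cube0 (k - n + 1)" "v \<in> cube n" "n \<le> k"
  shows "p + v \<in> cube k"
proof -
  have "(p + v) $ i \<in> {1..int k}" for i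
  proof -
    have "0 \<le> p $ i" "p $ i < int (k - n + 1)" "1 \<le> v $ i" "v $ i \<le> int n"
      using assms by (auto simp: cube0_def cube_def)
    then show ?thesis using assms(3) by (simp add: of_nat_diff)
  qed
  then show ?thesis by (simp add: cube_def)
qed

lemma cube0_mono: "j \<le> k \<Longrightarrow> cube0 j \<subseteq> cube0 k"
  unfolding cube0_def by fastforce

text \<open>With \<open>j\<close> distinct windows, all but at most \<open>j\<close> offsets carry a
  window that already occurs at an offset with smaller \<open>\<phi>\<close>. These offsets form the
  set \<open>P u\<close> for \<open>card_by_selection\<close>, and the covered sites are copied from
  earlier ones.\<close>

lemma card_few_windows:
  fixes A :: "'a set"
  assumes A: "finite A" "A \<noteq> {}" and m: "0 < m" "2 * m \<le> n" "n \<le> k"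
  shows "card {u \<in> patterns A k. card (pattern_at n u ` (cube0 (k - n + 1) :: (int ^ 'd) set)) = j}
    \<le> (k ^ (2 * CARD('d)) + 1) ^ ((k div m + 1) ^ CARD('d))
      * card A ^ (k ^ CARD('d) - ((k - n + 1) ^ CARD('d) - j))"
proof -
  let ?Q = "cube0 (k - n + 1) :: (int ^ 'd) set"
  \<comment> \<open>Differences of offsets: if \<open>\<phi>\<close> vanishes on none of them except
    0, it separates the offsets.\<close>
  define D where "D = (\<lambda>(p, q). p - q) ` (?Q \<times> ?Q)"
  have "finite D" by (simp add: D_def)
  from exists_separating_weights[OF this] obtain w :: "'d \<Rightarrow> int"
    where w: "\<forall>i. 0 \<le> w i" "\<forall>z\<in>D. (\<Sum>i\<in>UNIV. w i * z $ i) = 0 \<longrightarrow> z = 0"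
    by (elim exE conjE)
  define \<phi> where "\<phi> z = (\<Sum>i\<in>UNIV. w i * z $ i)" for z :: "int ^ 'd"
  have \<phi>_add: "\<phi> (y + z) = \<phi> y + \<phi> z" for y z
    by (simp add: \<phi>_def distrib_left sum.distrib)
  have \<phi>_inj: "p = q" if "p \<in> ?Q" "q \<in> ?Q" "\<phi> p = \<phi> q" for p q
  proof -
    have "\<phi> (p - q) = 0" using \<phi>_add[of "p - q" q] that(3) by simp
    moreover have "p - q \<in> D" using that unfolding D_def by (intro image_eqI[of _ _ "(p, q)"]) auto
    ultimately have "p - q = 0" using w(2) unfolding \<phi>_def by blast
    then show ?thesis by simp
  qed
  have \<phi>_nonneg: "0 \<le> \<phi> z" if "z \<in> cube k" for z
  proof -
    have "1 \<le> z $ i" for i using that by (auto simp: cube_def)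
    then have "0 \<le> z $ i" for i by (meson order_trans zero_le_one)
    then show ?thesis unfolding \<phi>_def using w(1) by (intro sum_nonneg mult_nonneg_nonneg) auto
  qed
  define \<theta> where "\<theta> u p q \<longleftrightarrow> q \<in> ?Q \<and> \<phi> q < \<phi> p \<and> pattern_at n u q = pattern_at n u p"
    for u :: "int ^ 'd \<Rightarrow> 'a" and p q
  define P where "P u = {p \<in> ?Q. \<exists>q. \<theta> u p q}" for u
  have Q: "?Q \<subseteq> cube0 k" using m by (intro cube0_mono) linarith
  show ?thesis
  proof (rule card_by_selection[where P = P and \<theta> = \<theta>, OF A _ m])
    show "P u \<subseteq> cube0 k" for u
      using Q unfolding P_def by blast
    show "\<exists>q\<in>cube0 k. \<theta> u p q" if "p \<in> P u" for u p
      using that Q unfolding P_def \<theta>_def by blast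
  next
    fix u assume u: "u \<in> {u \<in> patterns A k. card (pattern_at n u ` ?Q) = j}"
    \<comment> \<open>Of two equal windows at different offsets, one has the smaller
      \<open>\<phi>\<close>, so the other offset lies in \<open>P u\<close>.\<close>
    have "inj_on (pattern_at n u) (?Q - P u)"
    proof (rule inj_onI)
      fix p q assume pq: "p \<in> ?Q - P u" "q \<in> ?Q - P u" and eq: "pattern_at n u p = pattern_at n u q"
      from pq have "\<not> \<theta> u p q" "\<not> \<theta> u q p" by (auto simp: P_def)
      with pq eq have "\<phi> p = \<phi> q" by (auto simp: \<theta>_def)
      with pq show "p = q" by (intro \<phi>_inj) auto
    qed
    then have "card (?Q - P u) = card (pattern_at n u ` (?Q - P u))" by (simp add: card_image)
    also have "\<dots> \<le> card (pattern_at n u ` ?Q)" by (intro card_mono) auto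
    also have "\<dots> = j" using u by simp
    finally have "card (?Q - P u) \<le> j" .
    moreover have "card (?Q - P u) = card ?Q - card (P u)"
      by (intro card_Diff_subset finite_subset[of "P u" ?Q]) (auto simp: P_def)
    ultimately have "(k - n + 1) ^ CARD('d) - j \<le> card (P u)" by simp
    then show "(k - n + 1) ^ CARD('d) - j \<le> card (P u) \<or>
        P u \<noteq> {} \<and> (k - n + 1) ^ CARD('d) - j \<le> n ^ CARD('d)" ..
  next
    fix R u v
    assume u: "u \<in> {u \<in> patterns A k. card (pattern_at n u ` ?Q) = j}"
      and v: "v \<in> {u \<in> patterns A k. card (pattern_at n u ` ?Q) = j}"
      and R: "\<And>p q. (p, q) \<in> R \<Longrightarrow> p \<in> P u \<and> p \<in> P v \<and> \<theta> u p q \<and> \<theta> v p q"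
      and eq: "\<And>z. z \<in> cube k \<Longrightarrow> z \<notin> covered k n (fst ` R) \<Longrightarrow> u z = v z"
    \<comment> \<open>Induction along \<open>\<phi>\<close>: a covered site \<open>p + x\<close>
      takes its value from \<open>q + x\<close>, where \<open>\<phi>\<close> is smaller. Nonnegative
      weights make \<open>\<phi>\<close> nonnegative on \<open>cube k\<close>, so \<open>nat\<close>
      keeps the inequality strict.\<close>
    have "u z = v z" if "z \<in> cube k" for z
      using that
    proof (induction "nat (\<phi> z)" arbitrary: z rule: less_induct)
      case less
      show ?case
      proof (cases "z \<in> covered k n (fst ` R)")
        case True
        then obtain p q x where pq: "(p, q) \<in> R" and x: "x \<in> cube n" and z: "z = wrap k (p + x)"
          unfolding covered_def by force
        from R[OF pq] have *: "p \<in> ?Q" "q \<in> ?Q" "\<phi> q < \<phi> p"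
          "pattern_at n u q = pattern_at n u p" "pattern_at n v q = pattern_at n v p"
          by (auto simp: P_def \<theta>_def)
        have in_cube: "p + x \<in> cube k" "q + x \<in> cube k"
          using cube0_plus_cube * x m by blast+
        then have z: "z = p + x" by (simp add: z wrap_id)
        have "u (q + x) = v (q + x)"
          using \<phi>_nonneg[OF in_cube(2)] *(3) in_cube(2) by (intro less) (auto simp: z \<phi>_add)
        then show ?thesis
          using pattern_at_eqD[OF *(4) x] pattern_at_eqD[OF *(5) x] by (simp add: z)
      next
        case False
        then show ?thesis using eq less.prems by blast
      qed
    qed
    moreover have "u \<in> patterns A k" "v \<in> patterns A k" using u v by simp_all
    ultimately show "u = v" by (intro patterns_eqI[of u A k v])
  qed auto
qed

section \<open>Windows of periodic configurations\<close>

definition torus_windows :: "nat \<Rightarrow> nat \<Rightarrow> (int ^ 'd \<Rightarrow> 'a) \<Rightarrow> (int ^ 'd \<Rightarrow> 'a) set" where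
  "torus_windows k n u = pattern_at n (periodic_ext k u) ` cube0 k"

definition distinct_windows :: "'a set \<Rightarrow> nat \<Rightarrow> nat \<Rightarrow> (int ^ 'd \<Rightarrow> 'a) set" where
  "distinct_windows A k n = {u \<in> patterns A k. inj_on (pattern_at n (periodic_ext k u)) (cube0 k)}"

lemma periodic_ext_in_Pi: "0 < k \<Longrightarrow> u \<in> patterns A k \<Longrightarrow> periodic_ext k u \<in> UNIV \<rightarrow> A"
  unfolding periodic_ext_def patterns_def using PiE_mem[OF _ wrap_in_cube] by blast

lemma pattern_at_periodic_ext_eqD:
  "pattern_at n (periodic_ext k u) p = pattern_at n (periodic_ext k v) q \<Longrightarrow> x \<in> cube n \<Longrightarrow>
    u (wrap k (p + x)) = v (wrap k (q + x))"
  using pattern_at_eqD[of n "periodic_ext k u" p "periodic_ext k v" q x] by (simp add: periodic_ext_def)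

text \<open>The source of every repeated window is the fixed \<open>u\<close>, so \<open>v\<close>
  is known on all covered sites at once, without induction. A single common window already covers
  \<open>n ^ CARD('d)\<close> sites, which explains the maximum.\<close>

lemma card_common_windows:
  fixes A :: "'a set" and u :: "int ^ 'd \<Rightarrow> 'a"
  assumes A: "finite A" "A \<noteq> {}" and m: "0 < m" "2 * m \<le> n" "n \<le> k" and "0 < s"
  shows "card {v \<in> distinct_windows A k n. card (torus_windows k n u \<inter> torus_windows k n v) = s}
    \<le> (k ^ (2 * CARD('d)) + 1) ^ ((k div m + 1) ^ CARD('d)) * card A ^ (k ^ CARD('d) - max s (n ^ CARD('d)))"
proof -
  let ?F = "{v \<in> distinct_windows A k n. card (torus_windows k n u \<inter> torus_windows k n v) = s}"
  define \<theta> where "\<theta> v p q \<longleftrightarrow> pattern_at n (periodic_ext k v) p = pattern_at n (periodic_ext k u) q" for v p q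
  define P where "P v = {p \<in> cube0 k. pattern_at n (periodic_ext k v) p \<in> torus_windows k n u}" for v
  show ?thesis
  proof (rule card_by_selection[where P = P and \<theta> = \<theta>, OF A _ m])
    show "?F \<subseteq> patterns A k" by (auto simp: distinct_windows_def)
    show "P v \<subseteq> cube0 k" for v by (auto simp: P_def)
    show "\<exists>q\<in>cube0 k. \<theta> v p q" if "p \<in> P v" for v p
      using that by (auto simp: P_def \<theta>_def torus_windows_def)
  next
    fix v assume v: "v \<in> ?F"
    \<comment> \<open>As the windows of \<open>v\<close> are distinct, offsets in \<open>P v\<close>
      correspond one to one to common windows.\<close>
    have "pattern_at n (periodic_ext k v) ` P v = torus_windows k n u \<inter> torus_windows k n v"
      unfolding P_def torus_windows_def[of k n v] by blast
    moreover have "inj_on (pattern_at n (periodic_ext k v)) (P v)"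
      using v by (auto simp: distinct_windows_def P_def intro: inj_on_subset)
    ultimately have "card (P v) = s" using v card_image by fastforce
    with \<open>0 < s\<close> show "max s (n ^ CARD('d)) \<le> card (P v) \<or> P v \<noteq> {} \<and> max s (n ^ CARD('d)) \<le> n ^ CARD('d)"
      by (auto simp: max_def)
  next
    fix R v v'
    assume v: "v \<in> ?F" "v' \<in> ?F"
      and R: "\<And>p q. (p, q) \<in> R \<Longrightarrow> p \<in> P v \<and> p \<in> P v' \<and> \<theta> v p q \<and> \<theta> v' p q"
      and eq: "\<And>z. z \<in> cube k \<Longrightarrow> z \<notin> covered k n (fst ` R) \<Longrightarrow> v z = v' z"
    show "v = v'"
    proof (rule patterns_eqI[of v A k])
      fix z :: "int ^ 'd" assume "z \<in> cube k"
      show "v z = v' z"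
      proof (cases "z \<in> covered k n (fst ` R)")
        case True
        then obtain p q x where pq: "(p, q) \<in> R" and x: "x \<in> cube n" and z: "z = wrap k (p + x)"
          unfolding covered_def by force
        from R[OF pq] have "pattern_at n (periodic_ext k v) p = pattern_at n (periodic_ext k v') p"
          by (simp add: \<theta>_def)
        then show ?thesis unfolding z using x by (rule pattern_at_periodic_ext_eqD)
      qed (use eq \<open>z \<in> cube k\<close> in auto)
    qed (use v in \<open>auto simp: distinct_windows_def\<close>)
  qed
qed

lemma wrap_component_mod: "(wrap k z $ i - 1 - c) mod int k = (z $ i - 1 - c) mod int k"
  by (simp add: wrap_def mod_diff_left_eq)

text \<open>Overlapping translates of a window on the torus could close up cyclically; measuring the
  displacement in one coordinate, in the direction in which it is at most half a period, excludes this.\<close>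

lemma card_repeated_window_aux:
  fixes A :: "'a set" and p q :: "int ^ 'd"
  assumes A: "finite A" "A \<noteq> {}" and k: "2 * n \<le> k" "0 < n"
    and t: "0 < (q $ i - p $ i) mod int k" "2 * ((q $ i - p $ i) mod int k) \<le> int k"
  shows "card {u \<in> patterns A k. pattern_at n (periodic_ext k u) p = pattern_at n (periodic_ext k u) q}
    \<le> card A ^ (k ^ CARD('d) - n ^ CARD('d))"
proof -
  let ?F = "{u \<in> patterns A k. pattern_at n (periodic_ext k u) p = pattern_at n (periodic_ext k u) q}"
  define t where "t = (q $ i - p $ i) mod int k"
  \<comment> \<open>\<open>rank\<close> tells how far a site lies beyond \<open>p\<close> in
    direction \<open>i\<close> on the torus. Since \<open>t\<close> and \<open>n\<close> are at most
    half of \<open>k\<close>, the window at \<open>q\<close> has ranks from \<open>t\<close> to at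
    most \<open>t + n - 1 < k\<close>, so each of its sites copies one of smaller rank.\<close>
  define rank where "rank z = nat ((z $ i - 1 - p $ i) mod int k)" for z :: "int ^ 'd"
  have rank: "rank (wrap k (p + x)) < rank (wrap k (q + x))" if "x \<in> cube n" for x
  proof -
    have x: "1 \<le> x $ i" "x $ i \<le> int n" using that by (auto simp: cube_def)
    have "((q + x) $ i - 1 - p $ i) mod int k = ((q $ i - p $ i) + (x $ i - 1)) mod int k"
      by (simp add: algebra_simps)
    also have "\<dots> = (t + (x $ i - 1)) mod int k" by (simp add: t_def mod_add_left_eq)
    also have "\<dots> = t + (x $ i - 1)"
      using x t k by (intro mod_pos_pos_trivial) (auto simp: t_def)
    finally have "((q + x) $ i - 1 - p $ i) mod int k = t + (x $ i - 1)" .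
    moreover have "((p + x) $ i - 1 - p $ i) mod int k = x $ i - 1"
      using x k by (subst mod_pos_pos_trivial) auto
    ultimately show ?thesis unfolding rank_def wrap_component_mod using t(1) x by (simp add: t_def)
  qed
  have "card ?F \<le> card A ^ (card (cube k :: (int ^ 'd) set) - n ^ CARD('d))"
  proof (rule card_determined[where U = "covered k n {q}"])
    show "?F \<subseteq> cube k \<rightarrow>\<^sub>E A" by (auto simp: patterns_def)
    show "n ^ CARD('d) \<le> card (covered k n {q})"
      using k by (simp add: covered_def card_image inj_on_wrap_cube)
    fix u v assume u: "u \<in> ?F" and v: "v \<in> ?F"
      and eq: "\<And>z. z \<in> cube k - covered k n {q} \<Longrightarrow> u z = v z"
    have "u z = v z" if "z \<in> cube k" for z
      using that
    proof (induction "rank z" arbitrary: z rule: less_induct)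
      case less
      show ?case
      proof (cases "z \<in> covered k n {q}")
        case True
        then obtain x where x: "x \<in> cube n" and z: "z = wrap k (q + x)"
          by (auto simp: covered_def)
        have "u (wrap k (p + x)) = v (wrap k (p + x))"
          using rank[OF x] k by (intro less) (auto simp: z wrap_in_cube)
        moreover have "u (wrap k (p + x)) = u z" "v (wrap k (p + x)) = v z"
          unfolding z using u v x pattern_at_periodic_ext_eqD[of n k _ p _ q x] by blast+
        ultimately show ?thesis by simp
      next
        case False
        then show ?thesis using eq less.prems by blast
      qed
    qed
    moreover have "u \<in> patterns A k" "v \<in> patterns A k" using u v by simp_all
    ultimately show "u = v" by (intro patterns_eqI[of u A k v])
  qed (use A k covered_subset[of k n] in auto)
  then show ?thesis by simp
qed

text \<open>In a coordinate where \<open>p\<close> and \<open>q\<close> differ, the two residues of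
  the displacements add up to \<open>k\<close>, so one is at most half a period; the coincidence is
  symmetric in \<open>p\<close> and \<open>q\<close>.\<close>

lemma card_repeated_window:
  fixes A :: "'a set" and p q :: "int ^ 'd"
  assumes A: "finite A" "A \<noteq> {}" and k: "2 * n \<le> k" "0 < n"
    and pq: "p \<in> cube0 k" "q \<in> cube0 k" "p \<noteq> q"
  shows "card {u \<in> patterns A k. pattern_at n (periodic_ext k u) p = pattern_at n (periodic_ext k u) q}
    \<le> card A ^ (k ^ CARD('d) - n ^ CARD('d))"
proof -
  obtain i where i: "p $ i \<noteq> q $ i" using pq(3) by (auto simp: vec_eq_iff)
  let ?a = "q $ i - p $ i"
  have k0: "0 < int k" using k by simp
  have "0 \<le> p $ i" "p $ i < int k" "0 \<le> q $ i" "q $ i < int k"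
    using pq(1,2) by (auto simp: cube0_def)
  then have "\<bar>?a\<bar> < int k" by linarith
  then have "\<not> int k dvd ?a" using i dvd_imp_le_int[of ?a "int k"] by auto
  then have nz: "?a mod int k \<noteq> 0" by (simp add: dvd_eq_mod_eq_0)
  then have pos: "0 < ?a mod int k" using pos_mod_sign[OF k0, of ?a] by linarith
  have neg: "(p $ i - q $ i) mod int k = int k - ?a mod int k"
    using zmod_zminus1_eq_if[of ?a "int k"] nz by simp
  consider "2 * (?a mod int k) \<le> int k" | "2 * ((p $ i - q $ i) mod int k) \<le> int k" "0 < (p $ i - q $ i) mod int k"
    using neg pos_mod_bound[OF k0, of ?a] by linarith
  then show ?thesis
  proof cases
    case 1
    then show ?thesis using card_repeated_window_aux[OF A k pos] by simp
  next
    case 2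
    then have "card {u \<in> patterns A k. pattern_at n (periodic_ext k u) q = pattern_at n (periodic_ext k u) p}
        \<le> card A ^ (k ^ CARD('d) - n ^ CARD('d))"
      by (intro card_repeated_window_aux[OF A k]) auto
    then show ?thesis by (simp add: eq_commute)
  qed
qed

text \<open>Union bound over at most \<open>k ^ (2 * CARD('d))\<close> pairs of offsets. Each
  coincidence saves \<open>n ^ CARD('d)\<close> sites, and \<open>big\<close> keeps the total below
  or at half of all patterns.\<close>

lemma card_distinct_windows_ge:
  fixes A :: "'a set"
  assumes A: "finite A" "A \<noteq> {}" and k: "2 * n \<le> k" "0 < n"
    and big: "2 * k ^ (2 * CARD('d)) \<le> card A ^ (n ^ CARD('d))"
  shows "card A ^ (k ^ CARD('d)) \<le> 2 * card (distinct_windows A k n :: (int ^ 'd \<Rightarrow> 'a) set)"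
proof -
  let ?p = "patterns A k :: (int ^ 'd \<Rightarrow> 'a) set" and ?G = "distinct_windows A k n :: (int ^ 'd \<Rightarrow> 'a) set"
  define T :: "((int ^ 'd) \<times> (int ^ 'd)) set" where "T = {(p, q). p \<in> cube0 k \<and> q \<in> cube0 k \<and> p \<noteq> q}"
  have TS: "T \<subseteq> cube0 k \<times> cube0 k" by (auto simp: T_def)
  then have finT: "finite T" by (rule finite_subset) simp
  have cT: "card T \<le> k ^ (2 * CARD('d))"
    using card_mono[OF _ TS] by (simp add: card_cartesian_product power_add mult_2)
  define E where "E = (\<lambda>(p, q). {u \<in> ?p. pattern_at n (periodic_ext k u) p = pattern_at n (periodic_ext k u) q})"
  have "?p - ?G \<subseteq> (\<Union>t\<in>T. E t)"
    by (auto simp: distinct_windows_def inj_on_def T_def E_def)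
  moreover have "finite (\<Union>t\<in>T. E t)"
    using finT A by (auto simp: E_def)
  ultimately have "card (?p - ?G) \<le> card (\<Union>t\<in>T. E t)" by (intro card_mono)
  also have "\<dots> \<le> (\<Sum>t\<in>T. card (E t))" by (rule card_UN_le[OF finT])
  also have "\<dots> \<le> (\<Sum>t\<in>T. card A ^ (k ^ CARD('d) - n ^ CARD('d)))"
    using card_repeated_window[OF A k] by (intro sum_mono) (auto simp: T_def E_def)
  also have "\<dots> \<le> k ^ (2 * CARD('d)) * card A ^ (k ^ CARD('d) - n ^ CARD('d))"
    using cT by simp
  finally have "2 * card (?p - ?G) \<le> (2 * k ^ (2 * CARD('d))) * card A ^ (k ^ CARD('d) - n ^ CARD('d))"
    by simp
  also have "\<dots> \<le> card A ^ (n ^ CARD('d)) * card A ^ (k ^ CARD('d) - n ^ CARD('d))"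
    using big by (rule mult_right_mono) simp
  also have "\<dots> = card A ^ (k ^ CARD('d))"
    using k by (simp add: power_mono flip: power_add)
  also have "\<dots> = card ?p" by (simp add: card_patterns)
  finally have "2 * card (?p - ?G) \<le> card ?p" .
  moreover have "card (?p - ?G) = card ?p - card ?G"
    using A by (intro card_Diff_subset) (auto simp: distinct_windows_def)
  ultimately have "card ?p \<le> 2 * card ?G" by linarith
  then show ?thesis by (simp add: card_patterns)
qed

section \<open>Tiling with patterns that share a frame\<close>

lemma pattern_at_periodic_ext_in_torus_windows:
  assumes "0 < k"
  shows "pattern_at n (periodic_ext k u) p \<in> torus_windows k n u"
proof -
  define p' where "p' = (\<chi> i. p $ i mod int k)"
  have "wrap k (v + p) = wrap k (v + p')" for v
    by (simp add: wrap_eq_iff p'_def minus_mod_eq_mult_div)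
  then have "pattern_at n (periodic_ext k u) p = pattern_at n (periodic_ext k u) p'"
    by (simp add: pattern_at_def periodic_ext_def)
  moreover have "p' \<in> cube0 k" using assms by (simp add: cube0_def p'_def)
  ultimately show ?thesis unfolding torus_windows_def by blast
qed

text \<open>Any filling of the \<open>q ^ CARD('d)\<close> tiles by members of \<open>T\<close>
  gives a point of the shift, because each of its windows is also a window of the periodic extension
  of a single member. Different fillings differ on \<open>cube (q * k)\<close>.\<close>

lemma card_lang_sft_ge:
  fixes A :: "'a set" and T :: "(int ^ 'd \<Rightarrow> 'a) set"
  assumes n: "0 < n" "n \<le> k" and A: "finite A" and T: "T \<subseteq> patterns A k"
    and \<omega>: "\<And>u. u \<in> T \<Longrightarrow> torus_windows k n u \<subseteq> \<omega>"
    and frame: "\<And>u v z i. u \<in> T \<Longrightarrow> v \<in> T \<Longrightarrow> z \<in> cube k \<Longrightarrow> z $ i < int n \<Longrightarrow> u z = v z"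
    and "0 < q"
  shows "card T ^ (q ^ CARD('d)) \<le> card (lang (q * k) (sft A n \<omega>))"
proof (cases "T = {}")
  case False
  then obtain u0 where u0: "u0 \<in> T" by blast
  have k: "0 < k" using n by simp
  \<comment> \<open>Tiles outside the array all receive \<open>u0\<close>.\<close>
  define sel where "sel g b = (if b \<in> cube0 q then g b else u0)" for g :: "int ^ 'd \<Rightarrow> int ^ 'd \<Rightarrow> 'a" and b
  define x where "x g z = sel g (block k z) (wrap k z)" for g z
  let ?S = "(cube0 q :: (int ^ 'd) set) \<rightarrow>\<^sub>E T"
  have sel: "sel g b \<in> T" if "g \<in> ?S" for g b using that u0 by (auto simp: sel_def)
  \<comment> \<open>A window of side \<open>n\<close> meets the interior (the sites off the frame) of at most one tile.\<close>
  have x_sft: "x g \<in> sft A n \<omega>" if g: "g \<in> ?S" for g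
  proof -
    have "x g z \<in> A" for z
      using sel[OF g, of "block k z"] T wrap_in_cube[OF k, of z] unfolding x_def patterns_def by blast
    moreover have "pattern_at n (x g) p \<in> \<omega>" for p
    proof -
      define b where "b = (\<chi> i. p $ i div int k)"
      have "x g (v + p) = periodic_ext k (sel g b) (v + p)" if v: "v \<in> cube n" for v
      proof (cases "\<exists>i. wrap k (v + p) $ i < int n")
        case True
        then show ?thesis
          unfolding x_def periodic_ext_def using frame[OF sel[OF g] sel[OF g] wrap_in_cube[OF k]] by blast
      next
        case False
        \<comment> \<open>Off the frame the site lies at least \<open>n - 1\<close> steps past the
          start of its tile, so going back \<open>v $ i - 1\<close> steps to \<open>p\<close> does
          not leave the tile.\<close>
        have "(v $ i + p $ i - 1) div int k = p $ i div int k" for i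
        proof -
          let ?y = "v $ i + p $ i - 1"
          have "int n \<le> ?y mod int k + 1" using False by (auto simp: wrap_def not_less)
          moreover have "1 \<le> v $ i" "v $ i \<le> int n" using v by (auto simp: cube_def)
          moreover have "?y mod int k < int k" using k by simp
          moreover have "?y = int k * (?y div int k) + ?y mod int k" by simp
          ultimately have "p $ i = int k * (?y div int k) + (?y mod int k - (v $ i - 1))"
            "0 \<le> ?y mod int k - (v $ i - 1)" "?y mod int k - (v $ i - 1) < int k" by linarith+
          then show ?thesis by (metis int_div_pos_eq)
        qed
        then have "block k (v + p) = b" by (simp add: block_def b_def vec_eq_iff)
        then show ?thesis by (simp add: x_def periodic_ext_def)
      qed
      then have "pattern_at n (x g) p = pattern_at n (periodic_ext k (sel g b)) p"
        by (auto simp: pattern_at_def)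
      then show ?thesis
        using subsetD[OF \<omega>[OF sel[OF g]] pattern_at_periodic_ext_in_torus_windows[OF k]] by simp
    qed
    ultimately show ?thesis by (simp add: sft_def)
  qed
  have "inj_on (\<lambda>g. restrict (x g) (cube (q * k))) ?S"
  proof (rule inj_onI)
    fix g h assume g: "g \<in> ?S" and h: "h \<in> ?S"
      and eq: "restrict (x g) (cube (q * k)) = restrict (x h) (cube (q * k))"
    show "g = h"
    proof (rule PiE_ext[OF g h])
      fix b :: "int ^ 'd" assume b: "b \<in> cube0 q"
      have gb: "g b \<in> patterns A k" "h b \<in> patterns A k" using g h b T by blast+
      show "g b = h b"
      proof (rule patterns_eqI[OF gb])
        fix w :: "int ^ 'd" assume w: "w \<in> cube k"
        define z where "z = w + (\<chi> i. int k * b $ i)"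
        have "z $ i \<in> {1..int (q * k)}" for i
        proof -
          have "1 \<le> w $ i" "w $ i \<le> int k" "0 \<le> b $ i" "b $ i < int q"
            using w b by (auto simp: cube_def cube0_def)
          moreover from this have "int k * b $ i \<le> int k * (int q - 1)" by (intro mult_left_mono) auto
          moreover have "0 \<le> int k * b $ i" using \<open>0 \<le> b $ i\<close> by simp
          moreover have "int k * (int q - 1) = int (q * k) - int k" by (simp add: algebra_simps)
          moreover have "z $ i = w $ i + int k * b $ i" by (simp add: z_def)
          ultimately have "1 \<le> z $ i" "z $ i \<le> int (q * k)" by linarith+
          then show ?thesis by simp
        qed
        then have "z \<in> cube (q * k)" by (simp add: cube_def)
        then have "x g z = x h z" using eq by (metis restrict_apply')
        moreover have "wrap k z = w"
          using wrap_id[OF w] wrap_eq_iff[of k z w] by (simp add: z_def)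
        moreover from this have "block k z = b"
          using wrap_plus_block[of k z] k by (simp add: z_def vec_eq_iff)
        ultimately show "g b w = h b w" using b by (simp add: x_def sel_def)
      qed
    qed
  qed
  then have "card ?S = card ((\<lambda>g. restrict (x g) (cube (q * k))) ` ?S)" by (simp add: card_image)
  also have "\<dots> \<le> card (lang (q * k) (sft A n \<omega>))"
    using x_sft finite_lang[OF sft_subset A] by (intro card_mono) auto
  finally show ?thesis by (simp add: card_PiE)
qed (use \<open>0 < q\<close> in \<open>simp add: power_0_left\<close>)

lemma entropy_sft_ge:
  fixes A :: "'a set" and \<omega> :: "(int ^ 'd \<Rightarrow> 'a) set"
  assumes n: "0 < n" "n \<le> k" and A: "finite A" "A \<noteq> {}"
    and Y: "0 < card {u \<in> patterns A k. torus_windows k n u \<subseteq> \<omega>}"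
  shows "(ln (real (card {u \<in> patterns A k. torus_windows k n u \<subseteq> \<omega>}))
      - real (k ^ CARD('d) - (k - n + 1) ^ CARD('d)) * ln (real (card A))) / real k ^ CARD('d)
    \<le> entropy (sft A n \<omega>)"
proof -
  let ?Y = "{u \<in> patterns A k. torus_windows k n u \<subseteq> \<omega>}"
  \<comment> \<open>The frame lies along the lower faces only: the sites of \<open>cube k\<close>
    with some coordinate below \<open>n\<close>. Its complement \<open>I\<close> has side
    \<open>k - n + 1\<close>.\<close>
  define I :: "(int ^ 'd) set" where "I = {v. \<forall>i. v $ i \<in> {int n..int k}}"
  define Fr where "Fr = cube k - I"
  have IS: "I \<subseteq> cube k"
  proof
    fix v assume "v \<in> I"
    then have "int n \<le> v $ i \<and> v $ i \<le> int k" for i by (auto simp: I_def)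
    moreover have "1 \<le> int n" using n by simp
    ultimately show "v \<in> cube k" unfolding cube_def by (auto, meson order_trans)
  qed
  have cI: "card I = (k - n + 1) ^ CARD('d)" and finI: "finite I"
    unfolding I_def using n by (simp_all only: finite_vec_set card_vec_set finite_atLeastAtMost_int) (simp add: of_nat_diff nat_diff_distrib' Suc_diff_le nat_add_distrib)
  define N where "N = k ^ CARD('d) - (k - n + 1) ^ CARD('d)"
  have cFr: "card Fr = N"
    unfolding Fr_def N_def using IS finI cI by (simp add: card_Diff_subset)
  define S where "S = Fr \<rightarrow>\<^sub>E A"
  have S: "finite S" "card S = card A ^ N"
    using A by (auto simp: S_def Fr_def card_PiE cFr[unfolded Fr_def] intro!: finite_PiE)
  define fib where "fib f = {u \<in> ?Y. restrict u Fr = f}" for f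
  define c where "c = Max ((\<lambda>f. card (fib f)) ` S)"
  have "S \<noteq> {}" using A by (auto simp: S_def PiE_eq_empty_iff)
  then have "c \<in> (\<lambda>f. card (fib f)) ` S" unfolding c_def using S by (intro Max_in) auto
  then obtain f where f: "card (fib f) = c" by blast
  have "?Y = (\<Union>f\<in>S. fib f)"
    using IS by (fastforce simp: fib_def S_def patterns_def Fr_def)
  then have "card ?Y \<le> (\<Sum>f\<in>S. card (fib f))"
    using card_UN_le[OF S(1), of fib] by simp
  also have "\<dots> \<le> card S * c"
    unfolding c_def using S sum_bounded_above[of S "\<lambda>f. card (fib f)" c] by (simp add: c_def)
  finally have le: "card ?Y \<le> card A ^ N * c" using S by simp
  with Y have c0: "0 < c" by (cases "c = 0") auto
  have "ln (real c) / real k ^ CARD('d) \<le> entropy (sft A n \<omega>)"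
  proof (rule entropy_ge[OF sft_subset A(1) shift_inv_sft _ c0])
    show "0 < k" using n by simp
    show "c ^ (q ^ CARD('d)) \<le> card (lang (q * k) (sft A n \<omega>))" if "0 < q" for q
      unfolding f[symmetric]
    proof (rule card_lang_sft_ge[OF n A(1) _ _ _ that])
      fix u v and z :: "int ^ 'd" and i assume "u \<in> fib f" "v \<in> fib f" "z \<in> cube k" "z $ i < int n"
      then have "z \<in> Fr" "restrict u Fr = restrict v Fr" by (auto simp: Fr_def I_def fib_def not_le)
      then show "u z = v z" by (metis restrict_apply')
    qed (auto simp: fib_def)
  qed
  moreover have "ln (real (card ?Y)) \<le> ln (real (card A ^ N * c))"
    using Y le c0 A
    by (subst ln_le_cancel_iff) (auto simp: card_gt_0_iff simp flip: of_nat_mult of_nat_power)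
  moreover have "ln (real (card A ^ N * c)) = real N * ln (real (card A)) + ln (real c)"
    using c0 A by (simp add: ln_mult ln_realpow card_gt_0_iff)
  ultimately have "ln (real (card ?Y)) - real N * ln (real (card A)) \<le> ln (real c)"
    and e: "ln (real c) / real k ^ CARD('d) \<le> entropy (sft A n \<omega>)" by simp_all
  then have "(ln (real (card ?Y)) - real N * ln (real (card A))) / real k ^ CARD('d) \<le> ln (real c) / real k ^ CARD('d)"
    by (intro divide_right_mono) simp_all
  from order_trans[OF this e] show ?thesis unfolding N_def .
qed

section \<open>Tail estimates\<close>

text \<open>The left-hand side is a polynomial in \<open>real n ^ d\<close>. The factor 16 and the
  power \<open>L\<close> each receive half of the exponent, which fixes \<open>c'\<close>. The value
  16 is the largest constant needed in the tail estimates.\<close>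

lemma eventually_poly_le_exp:
  assumes "0 < c" "0 < C" "0 < d"
  shows "\<forall>\<^sub>F n in sequentially. 16 * (real (C * n) ^ (2 * d) + 1) ^ L \<le> exp (c * real n ^ d)"
proof -
  define D where "D = (real C ^ d)\<^sup>2"
  define c' where "c' = c / (2 * (real L + 1))"
  have D: "0 < D" and c': "0 < c'" using assms by (simp_all add: D_def c'_def)
  have "\<forall>\<^sub>F y in at_top. D * y\<^sup>2 + 1 \<le> exp (c' * y)" using D c' by real_asymp
  moreover have "\<forall>\<^sub>F y in at_top. 16 \<le> exp (c / 2 * y)" using assms by real_asymp
  moreover have "filterlim (\<lambda>n. real n ^ d) at_top sequentially"
    using assms by (intro filterlim_pow_at_top filterlim_real_sequentially)
  ultimately have "\<forall>\<^sub>F n in sequentially. D * (real n ^ d)\<^sup>2 + 1 \<le> exp (c' * real n ^ d)"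
    "\<forall>\<^sub>F n in sequentially. 16 \<le> exp (c / 2 * real n ^ d)"
    by (auto simp: filterlim_iff)
  then show ?thesis
  proof eventually_elim
    case (elim n)
    have "(real (C * n) ^ (2 * d) + 1) ^ L = (D * (real n ^ d)\<^sup>2 + 1) ^ L"
      by (simp add: D_def power_mult_distrib mult.commute flip: power_mult)
    also have "\<dots> \<le> exp (c' * real n ^ d) ^ L"
      using elim(1) D by (intro power_mono) auto
    also have "\<dots> = exp (real L * c' * real n ^ d)" by (simp add: exp_of_nat_mult mult.assoc)
    also have "\<dots> \<le> exp (c / 2 * real n ^ d)"
    proof -
      have "real L * c' \<le> c / 2" using assms by (simp add: c'_def field_simps)
      then show ?thesis unfolding exp_le_cancel_iff by (rule mult_right_mono) simp
    qed
    finally have "16 * (real (C * n) ^ (2 * d) + 1) ^ L \<le> exp (c / 2 * real n ^ d) * exp (c / 2 * real n ^ d)"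
      using elim(2) by (intro mult_mono) auto
    also have "\<dots> = exp (c * real n ^ d)" by (simp flip: exp_add)
    finally show ?case .
  qed
qed

text \<open>Bernoulli's inequality applied to \<open>(1 - 1 / C) ^ d\<close>, as
  \<open>k - n\<close> is \<open>k\<close> times \<open>1 - 1 / C\<close>. A large \<open>C\<close>
  makes the layer a small fraction of the cube.\<close>

lemma boundary_layer_le:
  assumes "0 < C" "k = C * n" "1 \<le> n"
  shows "real (k ^ d - (k - n + 1) ^ d) \<le> real d / real C * real k ^ d"
proof -
  have "real k ^ d * (1 + real d * (- 1 / real C)) \<le> real k ^ d * (1 + (- 1 / real C)) ^ d"
    using assms by (intro mult_left_mono Bernoulli_inequality) (auto simp: field_simps)
  also have "\<dots> = real (k - n) ^ d"
    using assms by (simp add: of_nat_diff algebra_simps flip: power_mult_distrib)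
  also have "\<dots> \<le> real (k - n + 1) ^ d" by (intro power_mono) auto
  finally have "real k ^ d - real (k - n + 1) ^ d \<le> real d / real C * real k ^ d"
    by (simp add: algebra_simps)
  moreover have "(k - n + 1) ^ d \<le> k ^ d"
    using assms by (cases C) (auto intro!: power_mono)
  ultimately show ?thesis by (simp add: of_nat_diff)
qed

text \<open>For cells of side \<open>n div 2\<close> the number of cells is bounded in terms of
  \<open>C\<close> and \<open>d\<close> alone, so the cost of the selections is polynomial in
  \<open>k\<close>. The constant 3 comes from rounding, with equality at
  \<open>n = 3\<close>.\<close>

lemma selection_factor_le:
  assumes "2 \<le> n" "k = C * n"
  shows "(k ^ (2 * d) + 1) ^ ((k div (n div 2) + 1) ^ d) \<le> (k ^ (2 * d) + 1) ^ ((3 * C + 1) ^ d)"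
proof -
  have "n \<le> 3 * (n div 2)" using assms(1) by presburger
  then have "k \<le> 3 * C * (n div 2)" using assms(2) by (metis mult.left_commute mult.assoc mult_le_mono2)
  then have "k div (n div 2) \<le> 3 * C"
    using assms(1) by (metis div_le_mono div_mult_self_is_m div_greater_zero_iff zero_less_numeral)
  then show ?thesis by (intro power_increasing power_mono) auto
qed

text \<open>Absorbs into the selection factor the number of terms in a sum over window counts; it is
  applied with \<open>x = real k ^ CARD('d)\<close>.\<close>

lemma polynomial_prefactor_le:
  fixes x :: real
  shows "(x + 1) * (x\<^sup>2 + 1) ^ L \<le> 2 * (x\<^sup>2 + 1) ^ (L + 1)"
proof -
  have "0 \<le> (x - 1 / 4)\<^sup>2" by simp
  then have "x + 1 \<le> 2 * (x\<^sup>2 + 1)" unfolding power2_eq_square by (simp add: algebra_simps)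
  then have "(x + 1) * (x\<^sup>2 + 1) ^ L \<le> (2 * (x\<^sup>2 + 1)) * (x\<^sup>2 + 1) ^ L"
    by (intro mult_right_mono) simp_all
  then show ?thesis by (simp only: power_add power_one_right mult_ac)
qed

lemma le_exp_log_plus: "0 \<le> x \<Longrightarrow> x \<le> exp (log_plus x)"
proof (cases "x = 0")
  case False
  moreover assume "0 \<le> x"
  ultimately have "x = exp (ln x)" by simp
  also have "\<dots> \<le> exp (log_plus x)" by (simp add: log_plus_def)
  finally show ?thesis .
qed simp

lemma log_plus_nonneg: "0 \<le> log_plus x"
  by (simp add: log_plus_def)

lemma sum_power_card_windows_le:
  fixes A :: "'a set" and \<alpha> :: real
  assumes A: "finite A" "A \<noteq> {}" and \<alpha>: "0 \<le> \<alpha>" and n: "2 \<le> n" "n \<le> k" "k = C * n"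
  shows "(\<Sum>u\<in>patterns A k. \<alpha> ^ card (pattern_at n u ` (cube0 (k - n + 1) :: (int ^ 'd) set)))
    \<le> 2 * (real k ^ (2 * CARD('d)) + 1) ^ ((3 * C + 1) ^ CARD('d) + 1)
      * real (card A) ^ (k ^ CARD('d) - (k - n + 1) ^ CARD('d))
      * exp (log_plus (\<alpha> * real (card A)) * real k ^ CARD('d))"
proof -
  define W where "W u = pattern_at n u ` (cube0 (k - n + 1) :: (int ^ 'd) set)" for u :: "int ^ 'd \<Rightarrow> 'a"
  define K where "K = (k - n + 1) ^ CARD('d)"
  define \<Lambda> where "\<Lambda> = (k ^ (2 * CARD('d)) + 1) ^ ((3 * C + 1) ^ CARD('d))"
  define a where "a = real (card A)"
  define h where "h = log_plus (\<alpha> * a)"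
  have a: "1 \<le> a" using A by (simp add: a_def Suc_le_eq card_gt_0_iff)
  have Kk: "K \<le> k ^ CARD('d)" unfolding K_def using n by (intro power_mono) linarith+
  have WK: "card (W u) \<le> K" for u
    unfolding W_def K_def by (rule order_trans[OF card_image_le]) simp_all
  have count: "real (card {u \<in> patterns A k. card (W u) = j}) * \<alpha> ^ j
      \<le> real \<Lambda> * a ^ (k ^ CARD('d) - K) * exp (h * real k ^ CARD('d))" if "j \<in> {..K}" for j
  proof -
    have j: "j \<le> K" using that by simp
    have "card {u \<in> patterns A k. card (W u) = j}
        \<le> (k ^ (2 * CARD('d)) + 1) ^ ((k div (n div 2) + 1) ^ CARD('d))
          * card A ^ (k ^ CARD('d) - (K - j))"
      unfolding W_def K_def using n by (intro card_few_windows A) auto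
    also have "\<dots> \<le> \<Lambda> * card A ^ (k ^ CARD('d) - (K - j))"
      unfolding \<Lambda>_def using n by (intro mult_right_mono selection_factor_le) auto
    finally have "real (card {u \<in> patterns A k. card (W u) = j}) \<le> real (\<Lambda> * card A ^ (k ^ CARD('d) - (K - j)))"
      unfolding of_nat_le_iff .
    then have "real (card {u \<in> patterns A k. card (W u) = j}) * \<alpha> ^ j
        \<le> real \<Lambda> * a ^ (k ^ CARD('d) - (K - j)) * \<alpha> ^ j"
      using \<alpha> by (intro mult_right_mono) (simp_all add: a_def)
    \<comment> \<open>Sites not saved: the boundary layer and one site for each distinct
      window.\<close>
    also have "k ^ CARD('d) - (K - j) = (k ^ CARD('d) - K) + j" using j Kk by simp
    also have "real \<Lambda> * a ^ ((k ^ CARD('d) - K) + j) * \<alpha> ^ j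
        = real \<Lambda> * a ^ (k ^ CARD('d) - K) * (\<alpha> * a) ^ j"
      by (simp add: power_add power_mult_distrib mult_ac)
    also have "\<dots> \<le> real \<Lambda> * a ^ (k ^ CARD('d) - K) * exp (h * real k ^ CARD('d))"
    proof (intro mult_left_mono)
      have "(\<alpha> * a) ^ j \<le> exp h ^ j"
        unfolding h_def using \<alpha> a by (intro power_mono le_exp_log_plus) auto
      also have "\<dots> = exp (h * real j)" by (simp add: exp_of_nat2_mult)
      also have "\<dots> \<le> exp (h * real k ^ CARD('d))"
        using j Kk by (simp add: h_def log_plus_nonneg mult_left_mono flip: of_nat_power)
      finally show "(\<alpha> * a) ^ j \<le> exp (h * real k ^ CARD('d))" .
    qed (use a in simp)
    finally show ?thesis .
  qed
  have "(\<Sum>u\<in>patterns A k. \<alpha> ^ card (W u))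
      = (\<Sum>j\<in>{..K}. \<Sum>u\<in>{u \<in> patterns A k. card (W u) = j}. \<alpha> ^ card (W u))"
    using A WK by (intro sum.group[symmetric]) auto
  also have "\<dots> = (\<Sum>j\<in>{..K}. real (card {u \<in> patterns A k. card (W u) = j}) * \<alpha> ^ j)"
    by (intro sum.cong refl) simp
  also have "\<dots> \<le> (\<Sum>j\<in>{..K}. real \<Lambda> * a ^ (k ^ CARD('d) - K) * exp (h * real k ^ CARD('d)))"
    by (intro sum_mono count)
  also have "\<dots> = (real K + 1) * real \<Lambda> * a ^ (k ^ CARD('d) - K) * exp (h * real k ^ CARD('d))"
    by (simp add: add.commute mult.assoc)
  also have "\<dots> \<le> 2 * (real k ^ (2 * CARD('d)) + 1) ^ ((3 * C + 1) ^ CARD('d) + 1)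
      * a ^ (k ^ CARD('d) - K) * exp (h * real k ^ CARD('d))"
  proof (intro mult_right_mono)
    have "(real K + 1) * real \<Lambda> \<le> (real k ^ CARD('d) + 1) * real \<Lambda>"
      using Kk by (intro mult_right_mono) (auto simp flip: of_nat_power)
    also have "\<dots> \<le> 2 * (real k ^ (2 * CARD('d)) + 1) ^ ((3 * C + 1) ^ CARD('d) + 1)"
      using polynomial_prefactor_le[of "real k ^ CARD('d)" "(3 * C + 1) ^ CARD('d)"]
      by (simp add: \<Lambda>_def add.commute mult.commute flip: power_mult)
    finally show "(real K + 1) * real \<Lambda> \<le> 2 * (real k ^ (2 * CARD('d)) + 1) ^ ((3 * C + 1) ^ CARD('d) + 1)" .
  qed (use a in simp_all)
  finally show ?thesis unfolding W_def K_def a_def h_def .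
qed

lemma upper_tail:
  fixes A :: "'a set" and \<alpha> \<epsilon> :: real
  assumes A: "finite A" "A \<noteq> {}" and \<alpha>: "\<alpha> \<in> {0..1}" and \<epsilon>: "\<epsilon> > 0"
  shows "\<forall>\<^sub>F n in sequentially.
    measure_pmf.prob (random_patterns A n \<alpha>)
      {\<omega> :: (int ^ 'd \<Rightarrow> 'a) set. log_plus (\<alpha> * real (card A)) + \<epsilon> \<le> entropy (sft A n \<omega>)}
      \<le> exp (- (\<epsilon> / 2) * real n ^ CARD('d))"
proof -
  define h where "h = log_plus (\<alpha> * real (card A))"
  define a where "a = real (card A)"
  \<comment> \<open>Large enough for the boundary layer to cost at most \<epsilon> / 4 per site; the
    added 1 keeps \<open>C\<close> positive.\<close>
  define C where "C = nat \<lceil>4 * real CARD('d) * ln a / \<epsilon>\<rceil> + 1"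
  have a: "1 \<le> a" using A by (simp add: a_def Suc_le_eq card_gt_0_iff)
  have C: "0 < C" "1 \<le> C" by (simp_all add: C_def)
  have "4 * real CARD('d) * ln a / \<epsilon> \<le> real C" unfolding C_def by linarith
  then have Cln: "real CARD('d) / real C * ln a \<le> \<epsilon> / 4"
    using C \<epsilon> by (simp add: field_simps)
  have "\<forall>\<^sub>F n in sequentially. 16 * (real (C * n) ^ (2 * CARD('d)) + 1) ^ ((3 * C + 1) ^ CARD('d) + 1)
      \<le> exp (\<epsilon> / 4 * real n ^ CARD('d))"
    using \<epsilon> C by (intro eventually_poly_le_exp) auto
  then show ?thesis
    using eventually_ge_at_top[of 2]
  proof eventually_elim
    case (elim n)
    define k where "k = C * n"
    define y where "y = real k ^ CARD('d)"
    define Q where "Q = 2 * (real k ^ (2 * CARD('d)) + 1) ^ ((3 * C + 1) ^ CARD('d) + 1)"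
    define t where "t = exp ((h + \<epsilon>) * y)"
    \<comment> \<open>Restrictions of points of the shift need not be periodic, so only windows that
      fit inside \<open>cube k\<close> are used.\<close>
    define W where "W u = pattern_at n u ` (cube0 (k - n + 1) :: (int ^ 'd) set)" for u :: "int ^ 'd \<Rightarrow> 'a"
    have nk: "n \<le> k" and k: "0 < k" using C elim by (auto simp: k_def)
    have ny: "real n ^ CARD('d) \<le> y" unfolding y_def using nk by (intro power_mono) auto
    have y: "0 < y" using k by (simp add: y_def)
    have W: "W u \<subseteq> patterns A n" if u: "u \<in> patterns A k" for u
    proof -
      have "u (v + p) \<in> A" if "p \<in> cube0 (k - n + 1)" "v \<in> cube n" for p v
        using cube0_plus_cube[OF that nk] u unfolding patterns_def by (metis PiE_mem add.commute)
      then show ?thesis unfolding W_def patterns_def pattern_at_def by auto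
    qed
    have "t \<le> real (card {u \<in> patterns A k. W u \<subseteq> \<omega>})"
      if "h + \<epsilon> \<le> entropy (sft A n \<omega>)" for \<omega> :: "(int ^ 'd \<Rightarrow> 'a) set"
    proof -
      let ?N = "card (lang k (sft A n \<omega>))"
      have "h + \<epsilon> \<le> lang_rate (sft A n \<omega>) k"
        using that entropy_le_lang_rate[OF sft_subset A(1) shift_inv_sft k] by (rule order_trans)
      then have ln: "(h + \<epsilon>) * y \<le> ln (real ?N)"
        using y by (simp add: lang_rate_def y_def field_simps)
      \<comment> \<open>Strict positivity rules out an empty language, for which
        \<open>ln 0 = 0\<close>.\<close>
      moreover have "0 < (h + \<epsilon>) * y" using y \<epsilon> log_plus_nonneg by (simp add: h_def add_nonneg_pos)
      ultimately have "0 < ln (real ?N)" by linarith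
      then have "0 < real ?N" by (cases "?N = 0") auto
      then have "t \<le> real ?N" using ln by (simp add: t_def flip: ln_ge_iff)
      also have "?N \<le> card {u \<in> patterns A k. W u \<subseteq> \<omega>}"
      proof (intro card_mono image_subsetI CollectI conjI)
        fix x assume x: "x \<in> sft A n \<omega>"
        then show "restrict x (cube k) \<in> patterns A k"
          using lang_subset[OF sft_subset] by blast
        have "pattern_at n (restrict x (cube k)) p = pattern_at n x p" if "p \<in> cube0 (k - n + 1)" for p
          using cube0_plus_cube[OF that _ nk] by (auto simp: pattern_at_def add.commute)
        then show "W (restrict x (cube k)) \<subseteq> \<omega>" using x by (auto simp: W_def sft_def)
      qed (use A in simp)
      finally show ?thesis by simp
    qed
    then have "measure_pmf.prob (random_patterns A n \<alpha>)
        {\<omega> :: (int ^ 'd \<Rightarrow> 'a) set. h + \<epsilon> \<le> entropy (sft A n \<omega>)}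
      \<le> measure_pmf.prob (random_patterns A n \<alpha>) {\<omega>. t \<le> real (card {u \<in> patterns A k. W u \<subseteq> \<omega>})}"
      by (intro measure_pmf.finite_measure_mono) auto
    also have "\<dots> \<le> (\<Sum>u\<in>patterns A k. \<alpha> ^ card (W u)) / t"
      using A \<alpha> W by (intro first_moment_bound) (auto simp: t_def)
    also have "\<dots> \<le> (Q * a ^ (k ^ CARD('d) - (k - n + 1) ^ CARD('d)) * exp (h * y)) / t"
      unfolding W_def Q_def a_def y_def h_def t_def using \<alpha> elim(2) nk k_def
      by (intro divide_right_mono sum_power_card_windows_le A) auto
    \<comment> \<open>The polynomial prefactor and the boundary layer use \<epsilon> / 4 each,
      leaving \<epsilon> / 2 of the gain from \<open>t\<close>.\<close>
    also have "\<dots> \<le> (exp (\<epsilon> / 4 * y) * exp (\<epsilon> / 4 * y) * exp (h * y)) / t"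
    proof (intro divide_right_mono mult_right_mono mult_mono)
      have "1 * (real k ^ (2 * CARD('d)) + 1) ^ ((3 * C + 1) ^ CARD('d) + 1)
          \<le> 8 * (real k ^ (2 * CARD('d)) + 1) ^ ((3 * C + 1) ^ CARD('d) + 1)"
        by (intro mult_right_mono) auto
      then have "Q \<le> exp (\<epsilon> / 4 * real n ^ CARD('d))"
        using elim(1) unfolding Q_def k_def by linarith
      also have "\<dots> \<le> exp (\<epsilon> / 4 * y)" using ny \<epsilon> by simp
      finally show "Q \<le> exp (\<epsilon> / 4 * y)" .
      have "a ^ (k ^ CARD('d) - (k - n + 1) ^ CARD('d))
          = exp (real (k ^ CARD('d) - (k - n + 1) ^ CARD('d)) * ln a)"
        using a by (simp add: exp_of_nat_mult)
      also have "\<dots> \<le> exp ((real CARD('d) / real C * y) * ln a)"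
        unfolding y_def exp_le_cancel_iff using a elim C
        by (intro mult_right_mono boundary_layer_le[OF C(1) k_def]) auto
      also have "\<dots> \<le> exp (\<epsilon> / 4 * y)"
        using mult_right_mono[OF Cln, of y] y by (simp add: mult_ac)
      finally show "a ^ (k ^ CARD('d) - (k - n + 1) ^ CARD('d)) \<le> exp (\<epsilon> / 4 * y)" .
    qed (use a in \<open>simp_all add: t_def\<close>)
    also have "\<dots> = exp (- (\<epsilon> / 2) * y)"
      unfolding t_def by (simp add: algebra_simps flip: exp_add exp_diff)
    also have "\<dots> \<le> exp (- (\<epsilon> / 2) * real n ^ CARD('d))"
      using ny \<epsilon> by simp
    finally show ?case unfolding h_def .
  qed
qed

text \<open>Sorted by the number \<open>s\<close> of common windows. With
  \<open>r = max s (n ^ CARD('d))\<close>, the count loses \<open>card A ^ r\<close> and the weight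
  is at most \<open>(1 / \<alpha>) ^ r\<close>; since
  \<open>1 \<le> \<alpha> * real (card A)\<close>, the worst exponent is
  \<open>n ^ CARD('d)\<close>.\<close>

lemma sum_common_windows_le:
  fixes A :: "'a set" and u :: "int ^ 'd \<Rightarrow> 'a"
  assumes A: "finite A" "A \<noteq> {}" and \<alpha>: "0 < \<alpha>" "\<alpha> \<le> 1" "1 \<le> \<alpha> * real (card A)"
    and n: "2 \<le> n" "n \<le> k" "k = C * n"
  shows "(\<Sum>v\<in>{v \<in> distinct_windows A k n. torus_windows k n u \<inter> torus_windows k n v \<noteq> {}}.
      (1 / \<alpha>) ^ card (torus_windows k n u \<inter> torus_windows k n v))
    \<le> 2 * (real k ^ (2 * CARD('d)) + 1) ^ ((3 * C + 1) ^ CARD('d) + 1)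
      * real (card A) ^ (k ^ CARD('d)) / (\<alpha> * real (card A)) ^ (n ^ CARD('d))"
proof -
  let ?I = "\<lambda>v. torus_windows k n u \<inter> torus_windows k n v"
  let ?G = "distinct_windows A k n :: (int ^ 'd \<Rightarrow> 'a) set"
  define y where "y = n ^ CARD('d)"
  define \<Lambda> where "\<Lambda> = (k ^ (2 * CARD('d)) + 1) ^ ((3 * C + 1) ^ CARD('d))"
  define a where "a = real (card A)"
  have a: "1 \<le> a" using A by (simp add: a_def Suc_le_eq card_gt_0_iff)
  have fin: "finite ?G" using A by (simp add: distinct_windows_def)
  have yk: "y \<le> k ^ CARD('d)" unfolding y_def using n by (intro power_mono) auto
  have fI: "finite (?I v)" for v by (simp add: torus_windows_def)
  have cI: "card (?I v) \<le> k ^ CARD('d)" for v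
  proof -
    have "card (?I v) \<le> card (torus_windows k n u)"
      by (intro card_mono) (auto simp: torus_windows_def)
    also have "\<dots> \<le> card (cube0 k :: (int ^ 'd) set)" unfolding torus_windows_def by (rule card_image_le) simp
    finally show ?thesis by simp
  qed
  have count: "real (card {v \<in> ?G. card (?I v) = s}) * (1 / \<alpha>) ^ s
      \<le> real \<Lambda> * a ^ (k ^ CARD('d)) / (\<alpha> * a) ^ y" if "s \<in> {1..k ^ CARD('d)}" for s
  proof -
    define r where "r = max s y"
    have r: "s \<le> r" "y \<le> r" "r \<le> k ^ CARD('d)" using that yk by (auto simp: r_def)
    have "card {v \<in> ?G. card (?I v) = s}
        \<le> (k ^ (2 * CARD('d)) + 1) ^ ((k div (n div 2) + 1) ^ CARD('d)) * card A ^ (k ^ CARD('d) - r)"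
      unfolding r_def y_def using n that by (intro card_common_windows A) auto
    also have "\<dots> \<le> \<Lambda> * card A ^ (k ^ CARD('d) - r)"
      unfolding \<Lambda>_def using n by (intro mult_right_mono selection_factor_le) auto
    finally have "real (card {v \<in> ?G. card (?I v) = s}) \<le> real (\<Lambda> * card A ^ (k ^ CARD('d) - r))"
      unfolding of_nat_le_iff .
    then have "real (card {v \<in> ?G. card (?I v) = s}) * (1 / \<alpha>) ^ s
        \<le> real \<Lambda> * a ^ (k ^ CARD('d) - r) * (1 / \<alpha>) ^ r"
      using \<alpha> r(1) by (intro mult_mono power_increasing) (auto simp: a_def)
    also have "a ^ (k ^ CARD('d) - r) = a ^ (k ^ CARD('d)) / a ^ r"
      using a r(3) by (intro power_diff) auto
    also have "real \<Lambda> * (a ^ (k ^ CARD('d)) / a ^ r) * (1 / \<alpha>) ^ r = real \<Lambda> * a ^ (k ^ CARD('d)) / (\<alpha> * a) ^ r"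
      by (simp add: power_divide power_mult_distrib)
    also have "\<dots> \<le> real \<Lambda> * a ^ (k ^ CARD('d)) / (\<alpha> * a) ^ y"
      using a \<alpha> r(2) by (intro divide_left_mono power_increasing) (auto simp: a_def)
    finally show ?thesis .
  qed
  have "(\<Sum>v\<in>{v \<in> ?G. ?I v \<noteq> {}}. (1 / \<alpha>) ^ card (?I v))
      = (\<Sum>s\<in>{1..k ^ CARD('d)}. \<Sum>v\<in>{v \<in> {v \<in> ?G. ?I v \<noteq> {}}. card (?I v) = s}. (1 / \<alpha>) ^ card (?I v))"
  proof (intro sum.group[symmetric] image_subsetI)
    fix v assume "v \<in> {v \<in> ?G. ?I v \<noteq> {}}"
    then have "0 < card (?I v)" using fI by (simp add: card_gt_0_iff)
    with cI[of v] show "card (?I v) \<in> {1..k ^ CARD('d)}" by simp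
  qed (use rev_finite_subset[OF fin] in auto)
  also have "\<dots> = (\<Sum>s\<in>{1..k ^ CARD('d)}. real (card {v \<in> ?G. card (?I v) = s}) * (1 / \<alpha>) ^ s)"
  proof (intro sum.cong refl)
    fix s assume "s \<in> {1..k ^ CARD('d)}"
    then have "{v \<in> {v \<in> ?G. ?I v \<noteq> {}}. card (?I v) = s} = {v \<in> ?G. card (?I v) = s}" by force
    then show "(\<Sum>v\<in>{v \<in> {v \<in> ?G. ?I v \<noteq> {}}. card (?I v) = s}. (1 / \<alpha>) ^ card (?I v))
        = real (card {v \<in> ?G. card (?I v) = s}) * (1 / \<alpha>) ^ s" by simp
  qed
  also have "\<dots> \<le> (\<Sum>s\<in>{1..k ^ CARD('d)}. real \<Lambda> * a ^ (k ^ CARD('d)) / (\<alpha> * a) ^ y)"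
    by (intro sum_mono count)
  also have "\<dots> = (real k ^ CARD('d) * real \<Lambda>) * (a ^ (k ^ CARD('d)) / (\<alpha> * a) ^ y)"
    by simp
  also have "\<dots> \<le> (2 * (real k ^ (2 * CARD('d)) + 1) ^ ((3 * C + 1) ^ CARD('d) + 1)) * (a ^ (k ^ CARD('d)) / (\<alpha> * a) ^ y)"
  proof (intro mult_right_mono)
    have "real k ^ CARD('d) * real \<Lambda> \<le> (real k ^ CARD('d) + 1) * real \<Lambda>"
      by (intro mult_right_mono) auto
    also have "\<dots> \<le> 2 * (real k ^ (2 * CARD('d)) + 1) ^ ((3 * C + 1) ^ CARD('d) + 1)"
      using polynomial_prefactor_le[of "real k ^ CARD('d)" "(3 * C + 1) ^ CARD('d)"]
      by (simp add: \<Lambda>_def add.commute mult.commute flip: power_mult)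
    finally show "real k ^ CARD('d) * real \<Lambda> \<le> 2 * (real k ^ (2 * CARD('d)) + 1) ^ ((3 * C + 1) ^ CARD('d) + 1)" .
  qed (use a \<alpha> in simp)
  finally show ?thesis unfolding a_def y_def by simp
qed

lemma lower_tail:
  fixes A :: "'a set" and \<alpha> \<epsilon> :: real
  assumes A: "finite A" and \<alpha>: "\<alpha> \<in> {0..1}" and \<epsilon>: "\<epsilon> > 0" and super: "1 < \<alpha> * real (card A)"
  shows "\<forall>\<^sub>F n in sequentially.
    measure_pmf.prob (random_patterns A n \<alpha>)
      {\<omega> :: (int ^ 'd \<Rightarrow> 'a) set. entropy (sft A n \<omega>) \<le> log_plus (\<alpha> * real (card A)) - \<epsilon>}
      \<le> exp (- (log_plus (\<alpha> * real (card A)) / 2) * real n ^ CARD('d))"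
proof -
  define a where "a = real (card A)"
  define h where "h = ln (\<alpha> * a)"
  \<comment> \<open>As for the upper tail, but \<open>C \<ge> 2\<close> is needed for
    \<open>2 * n \<le> k\<close> in the count of repeated windows.\<close>
  define C where "C = nat \<lceil>4 * real CARD('d) * ln a / \<epsilon>\<rceil> + 2"
  have A': "A \<noteq> {}" using super by auto
  have a: "1 \<le> a" using A A' by (simp add: a_def Suc_le_eq card_gt_0_iff)
  have \<alpha>0: "0 < \<alpha>" using \<alpha> super by (cases "\<alpha> = 0") auto
  have h: "0 < h" using super by (simp add: h_def a_def)
  have hlog: "log_plus (\<alpha> * real (card A)) = h" using h by (simp add: log_plus_def h_def a_def)
  have "\<alpha> * a \<le> 1 * a" using \<alpha> a by (intro mult_right_mono) auto
  then have ha: "h \<le> ln a" unfolding h_def using super a by (subst ln_le_cancel_iff) (auto simp: a_def)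
  have C: "0 < C" "2 \<le> C" by (simp_all add: C_def)
  have "4 * real CARD('d) * ln a / \<epsilon> \<le> real C" unfolding C_def by linarith
  then have Cln: "real CARD('d) / real C * ln a \<le> \<epsilon> / 4"
    using C \<epsilon> by (simp add: field_simps)
  \<comment> \<open>The bound \<open>h / 2\<close> leaves half of the decay rate \<open>h\<close>;
    the bound \<epsilon> / 4 makes \<open>ln 4\<close> negligible against
    \<open>real N\<close>.\<close>
  define c where "c = min (h / 2) (\<epsilon> / 4)"
  have c: "0 < c" "c \<le> h / 2" "c \<le> \<epsilon> / 4" using h \<epsilon> by (auto simp: c_def)
  have "\<forall>\<^sub>F n in sequentially. 16 * (real (C * n) ^ (2 * CARD('d)) + 1) ^ ((3 * C + 1) ^ CARD('d) + 1)
      \<le> exp (c * real n ^ CARD('d))"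
    using c C by (intro eventually_poly_le_exp) auto
  then show ?thesis
    using eventually_ge_at_top[of 2]
  proof eventually_elim
    case (elim n)
    define k where "k = C * n"
    define N where "N = k ^ CARD('d)"
    define y where "y = real n ^ CARD('d)"
    define Q where "Q = (real k ^ (2 * CARD('d)) + 1) ^ ((3 * C + 1) ^ CARD('d) + 1)"
    define G where "G = (distinct_windows A k n :: (int ^ 'd \<Rightarrow> 'a) set)"
    define g where "g = real (card G)"
    have nk: "n \<le> k" "2 * n \<le> k" and k: "0 < k" using C elim(2) by (auto simp: k_def)
    have yN: "y \<le> real N" unfolding y_def N_def using nk by (auto intro: power_mono)
    have y: "1 \<le> y" using elim(2) by (simp add: y_def)
    have QE: "16 * Q \<le> exp (c * y)" using elim(1) unfolding Q_def k_def y_def .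
    have Q1: "1 \<le> Q" unfolding Q_def by (intro one_le_power) simp
    have ey: "exp (c * y) \<le> exp (h / 2 * y)" using c y by simp
    have pow_y: "x ^ (n ^ CARD('d)) = exp (ln x * y)" if "0 < x" for x :: real
      using that by (simp add: y_def exp_of_nat2_mult flip: of_nat_power)
    have "2 * k ^ (2 * CARD('d)) \<le> card A ^ (n ^ CARD('d))"
    proof -
      have "1 * real k ^ (2 * CARD('d)) \<le> (real k ^ (2 * CARD('d)) + 1) ^ 1" by simp
      also have "\<dots> \<le> Q" unfolding Q_def by (intro power_increasing) auto
      finally have "2 * real k ^ (2 * CARD('d)) \<le> exp (h / 2 * y)" using QE ey Q1 by linarith
      also have "\<dots> \<le> exp (ln a * y)" using ha h y by simp
      also have "\<dots> = a ^ (n ^ CARD('d))" using a by (simp add: pow_y)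
      finally have "real (2 * k ^ (2 * CARD('d))) \<le> real (card A ^ (n ^ CARD('d)))" by (simp add: a_def)
      then show ?thesis by (simp only: of_nat_le_iff)
    qed
    then have "card A ^ N \<le> 2 * card G"
      unfolding N_def G_def using elim(2) by (intro card_distinct_windows_ge A A' nk(2)) auto
    then have "real (card A ^ N) \<le> real (2 * card G)" by (simp only: of_nat_le_iff)
    then have aG: "a ^ N \<le> 2 * g" by (simp add: a_def g_def)
    have aN: "0 < a ^ N" using a by simp
    have g: "0 < g" using aG aN by linarith
    have finG: "finite G" using A by (simp add: G_def distinct_windows_def)
    have G0: "G \<noteq> {}" using g by (auto simp: g_def)
    have GP: "G \<subseteq> patterns A k" by (auto simp: G_def distinct_windows_def)
    have W: "torus_windows k n u \<subseteq> patterns A n" if "u \<in> G" for u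
      unfolding torus_windows_def using that GP pattern_at_in_patterns[OF periodic_ext_in_Pi[OF k]] by blast
    have cW: "card (torus_windows k n u) = N" if "u \<in> G" for u
      using that unfolding torus_windows_def G_def distinct_windows_def N_def by (simp add: card_image)
    have good: "h - \<epsilon> < entropy (sft A n \<omega>)"
      if "g * \<alpha> ^ N / 2 < real (card {u \<in> G. torus_windows k n u \<subseteq> \<omega>})" for \<omega>
    proof -
      let ?Y = "real (card {u \<in> patterns A k. torus_windows k n u \<subseteq> \<omega>})"
      have "card {u \<in> G. torus_windows k n u \<subseteq> \<omega>} \<le> card {u \<in> patterns A k. torus_windows k n u \<subseteq> \<omega>}"
        using A GP by (intro card_mono) auto
      then have gY: "g * \<alpha> ^ N / 2 < ?Y" using that by linarith
      \<comment> \<open>One factor 2 comes from half the mean, the other from \<open>G\<close>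
        holding at least half of all patterns.\<close>
      have "(\<alpha> * a) ^ N / 4 = a ^ N * \<alpha> ^ N / 4" by (simp add: power_mult_distrib)
      also have "\<dots> \<le> 2 * g * \<alpha> ^ N / 4" using aG \<alpha>0 by (intro divide_right_mono mult_right_mono) auto
      finally have Y: "(\<alpha> * a) ^ N / 4 < ?Y" using gY by simp
      have pos: "0 < \<alpha> * a" using super by (simp add: a_def)
      then have Y0: "0 < ?Y" using Y by (intro le_less_trans[OF _ Y]) simp
      have "ln ((\<alpha> * a) ^ N / 4) < ln ?Y" using Y Y0 pos by (subst ln_less_cancel_iff) auto
      moreover have "ln ((\<alpha> * a) ^ N / 4) = real N * h - ln 4"
        using pos ln_divide_pos[of "(\<alpha> * a) ^ N" 4] unfolding ln_realpow h_def by simp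
      moreover have "ln 4 \<le> \<epsilon> / 4 * real N"
      proof -
        have "ln 4 \<le> ln (exp (c * y))"
          using QE Q1 by (subst ln_le_cancel_iff) auto
        also have "\<dots> \<le> \<epsilon> / 4 * real N" using mult_mono[OF c(3) yN] \<epsilon> y by simp
        finally show ?thesis .
      qed
      moreover have "real (N - (k - n + 1) ^ CARD('d)) * ln a \<le> \<epsilon> / 4 * real N"
      proof -
        have "real (N - (k - n + 1) ^ CARD('d)) * ln a \<le> (real CARD('d) / real C * real k ^ CARD('d)) * ln a"
          unfolding N_def using a elim(2) C by (intro mult_right_mono boundary_layer_le[OF C(1) k_def]) auto
        also have "\<dots> \<le> \<epsilon> / 4 * real N"
          using mult_right_mono[OF Cln, of "real N"] by (simp add: N_def mult_ac)
        finally show ?thesis .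
      qed
      moreover have N0: "0 < real N" using y yN by linarith
      moreover from this \<epsilon> have "0 < \<epsilon> * real N" by simp
      \<comment> \<open>The constant 4 and the frame each cost at most a quarter of
        \<open>\<epsilon> * real N\<close>.\<close>
      ultimately have "(h - \<epsilon>) * real N < ln ?Y - real (N - (k - n + 1) ^ CARD('d)) * ln a"
        by (simp add: algebra_simps)
      then have "h - \<epsilon> < (ln ?Y - real (N - (k - n + 1) ^ CARD('d)) * ln a) / real N"
        using N0 by (simp add: pos_less_divide_eq)
      also have "\<dots> \<le> entropy (sft A n \<omega>)"
        using entropy_sft_ge[of n k A \<omega>] A A' nk elim(2) Y0 unfolding N_def a_def by simp
      finally show ?thesis .
    qed
    have "measure_pmf.prob (random_patterns A n \<alpha>)
        {\<omega> :: (int ^ 'd \<Rightarrow> 'a) set. entropy (sft A n \<omega>) \<le> h - \<epsilon>}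
      \<le> measure_pmf.prob (random_patterns A n \<alpha>)
        {\<omega>. real (card {u \<in> G. torus_windows k n u \<subseteq> \<omega>}) \<le> g * \<alpha> ^ N / 2}"
      using good by (intro measure_pmf.finite_measure_mono) (auto simp: not_less[symmetric])
    also have "\<dots> \<le> 4 / g\<^sup>2 * (\<Sum>u\<in>G. \<Sum>v\<in>{v \<in> G. torus_windows k n u \<inter> torus_windows k n v \<noteq> {}}.
        (1 / \<alpha>) ^ card (torus_windows k n u \<inter> torus_windows k n v))"
      unfolding g_def using A \<alpha> finG W \<alpha>0 G0 cW by (intro second_moment_bound) auto
    also have "\<dots> \<le> 4 / g\<^sup>2 * (\<Sum>u\<in>G. 2 * Q * a ^ N / (\<alpha> * a) ^ (n ^ CARD('d)))"
      unfolding Q_def a_def N_def G_def using \<alpha>0 \<alpha> super elim(2) nk k_def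
      by (intro mult_left_mono sum_mono sum_common_windows_le A A') auto
    \<comment> \<open>One factor \<open>g\<close> of the denominator cancels against the sum over
      \<open>G\<close>; the other is compared with \<open>a ^ N\<close>.\<close>
    also have "\<dots> = 8 * Q * (a ^ N / g) / (\<alpha> * a) ^ (n ^ CARD('d))"
      using g by (simp add: g_def[symmetric] power2_eq_square field_simps)
    also have "\<dots> \<le> 8 * Q * 2 / (\<alpha> * a) ^ (n ^ CARD('d))"
    proof (intro divide_right_mono mult_left_mono)
      show "a ^ N / g \<le> 2" using aG g by (simp add: divide_le_eq)
    qed (use Q1 super in \<open>auto simp: a_def\<close>)
    also have "\<dots> = 16 * Q / exp (h * y)"
      using super by (simp add: pow_y h_def a_def)
    also have "\<dots> \<le> exp (h / 2 * y) / exp (h * y)"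
      by (intro divide_right_mono order_trans[OF QE ey]) simp
    also have "\<dots> = exp (- (h / 2) * y)"
      by (simp flip: exp_diff)
    finally show ?case unfolding hlog y_def .
  qed
qed

theorem theorem1p2:
  fixes A :: "'a set" and \<alpha> \<epsilon> :: real
  assumes "finite A" and "\<alpha> \<in> {0..1}" and "\<epsilon> > 0"
  shows "\<exists>\<rho>>0. \<exists>n0. \<forall>n\<ge>n0.
    measure_pmf.prob (random_patterns A n \<alpha>)
      {\<omega> :: (int ^ 'd \<Rightarrow> 'a) set.
        \<bar>entropy (sft A n \<omega>) - log_plus (\<alpha> * real (card A))\<bar> \<ge> \<epsilon>}
      \<le> exp (- \<rho> * real n ^ CARD('d))"
proof (cases "A = {}")
  case True
  \<comment> \<open>Over the empty alphabet the shift is empty, and both the entropy and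
    \<open>log_plus 0\<close> are 0 because \<open>ln 0 = 0\<close>, so the event is empty.\<close>
  have "entropy (sft A n \<omega>) = 0" for n and \<omega> :: "(int ^ 'd \<Rightarrow> 'a) set"
  proof -
    have "sft A n \<omega> = {}" by (auto simp: sft_def True Pi_iff)
    then show ?thesis using limI[OF tendsto_const[of "0::real" sequentially]] by (simp add: entropy_def)
  qed
  then show ?thesis using assms(3) True by (auto simp: log_plus_def intro!: exI[of _ 1])
next
  case False
  define h where "h = log_plus (\<alpha> * real (card A))"
  define hi where "hi n = {\<omega> :: (int ^ 'd \<Rightarrow> 'a) set. h + \<epsilon> \<le> entropy (sft A n \<omega>)}" for n
  define lo where "lo n = {\<omega> :: (int ^ 'd \<Rightarrow> 'a) set. entropy (sft A n \<omega>) \<le> h - \<epsilon>}" for n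
  define bad where "bad n = {\<omega> :: (int ^ 'd \<Rightarrow> 'a) set. \<epsilon> \<le> \<bar>entropy (sft A n \<omega>) - h\<bar>}" for n
  let ?P = "\<lambda>n. measure_pmf.prob (random_patterns A n \<alpha>)"
  have hi: "\<forall>\<^sub>F n in sequentially. ?P n (hi n) \<le> exp (- (\<epsilon> / 2) * real n ^ CARD('d))"
    unfolding hi_def h_def by (rule upper_tail[OF assms(1) False assms(2,3)])
  have "\<exists>\<rho>>0. \<forall>\<^sub>F n in sequentially. ?P n (lo n) \<le> exp (- \<rho> * real n ^ CARD('d))"
  proof (cases "1 < \<alpha> * real (card A)")
    case True
    then have "0 < h / 2" by (simp add: h_def log_plus_def)
    then show ?thesis
      using lower_tail[OF assms True] unfolding h_def lo_def by blast
  next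
    case le: False
    \<comment> \<open>When \<open>\<alpha> * real (card A) \<le> 1\<close>, the lower deviation is
      impossible, since entropy is nonnegative.\<close>
    have "h = 0"
    proof (cases "\<alpha> * real (card A) = 0")
      case False
      then have "ln (\<alpha> * real (card A)) \<le> 0" using le assms(2) by simp
      then show ?thesis by (simp add: h_def log_plus_def)
    next
      case True
      show ?thesis unfolding h_def log_plus_def True by simp
    qed
    then have "h - \<epsilon> < entropy (sft A n \<omega>)" for n and \<omega> :: "(int ^ 'd \<Rightarrow> 'a) set"
      using entropy_nonneg[OF sft_subset assms(1) shift_inv_sft, of n \<omega>] assms(3) by linarith
    then have "lo n = {}" for n by (auto simp: lo_def not_le)
    then show ?thesis by (intro exI[of _ 1]) simp
  qed
  then obtain \<rho>0 where \<rho>0: "0 < \<rho>0"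
    and lo: "\<forall>\<^sub>F n in sequentially. ?P n (lo n) \<le> exp (- \<rho>0 * real n ^ CARD('d))" by blast
  \<comment> \<open>Half of the smaller rate; the other half absorbs the factor 2 of the union bound
    over the two tails.\<close>
  define \<rho> where "\<rho> = min (\<epsilon> / 2) \<rho>0 / 2"
  have \<rho>: "0 < \<rho>" "2 * \<rho> \<le> \<epsilon> / 2" "2 * \<rho> \<le> \<rho>0" using assms(3) \<rho>0 by (auto simp: \<rho>_def)
  \<comment> \<open>With exponent 0 this is
    \<open>16 \<le> exp (\<rho> * real n ^ CARD('d))\<close>, more than the factor 2 to be
    absorbed.\<close>
  have "\<forall>\<^sub>F n in sequentially. 16 * (real (1 * n) ^ (2 * CARD('d)) + 1) ^ 0 \<le> exp (\<rho> * real n ^ CARD('d))"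
    using \<rho> by (intro eventually_poly_le_exp) auto
  with hi lo have "\<forall>\<^sub>F n in sequentially. ?P n (bad n) \<le> exp (- \<rho> * real n ^ CARD('d))"
  proof eventually_elim
    case (elim n)
    define y where "y = real n ^ CARD('d)"
    have y: "0 \<le> y" by (simp add: y_def)
    have "bad n = hi n \<union> lo n"
      by (auto simp: bad_def hi_def lo_def abs_if)
    then have "?P n (bad n) \<le> ?P n (hi n) + ?P n (lo n)"
      by (simp add: measure_Un_le)
    also have "\<dots> \<le> exp (- (2 * \<rho>) * y) + exp (- (2 * \<rho>) * y)"
    proof (intro add_mono)
      show "?P n (hi n) \<le> exp (- (2 * \<rho>) * y)"
        using elim(1) mult_right_mono[OF \<rho>(2) y] unfolding y_def[symmetric]
        by (elim order_trans) simp
      show "?P n (lo n) \<le> exp (- (2 * \<rho>) * y)"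
        using elim(2) mult_right_mono[OF \<rho>(3) y] unfolding y_def[symmetric]
        by (elim order_trans) simp
    qed
    also have "\<dots> \<le> exp (\<rho> * y) * exp (- (2 * \<rho>) * y)"
      using elim(3) unfolding y_def by simp
    also have "\<dots> = exp (- \<rho> * y)" by (simp flip: exp_add)
    finally show ?case unfolding y_def .
  qed
  then show ?thesis
    unfolding eventually_sequentially h_def[symmetric] bad_def using \<rho>(1) by blast
qed

end
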